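(* Let $L$ be a planar triangulation with $n_L\ge 3$ vertices, embedded in the plane, and let $H$ be its planar conjugated triangulation. Then $H$ has an Eulerian circuit (a closed walk using every edge of $H$ exactly once), and this circuit passes exactly twice through every inner vertex of $H$.
   Context: A planar triangulation is a maximal planar simple graph; fix a plane embedding of $L$, so all faces of $L$ are triangles. The planar conjugated triangulation $H$ of $L$ is the plane graph whose vertices are the midpoints of the edges of $L$, and in which, for every bounded face of $L$, the three midpoints of its three boundary edges are joined pairwise by three segments drawn inside that face; nothing is drawn inside the unbounded face of $L$. A vertex of $H$ is called external if it lies on the boundary of the unbounded face of $H$, and inner otherwise. *)

theory Defs
  imports "HOL-Analysis.Analysis"
begin

text \<open>
  Graphs are given by a vertex set \<open>V\<close>, an edge set \<open>E\<close> and a map \<open>ends\<close> sending an edge to the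
  set of its endpoints, so that parallel edges are not identified. For a simple graph the edges
  are themselves two-element sets of vertices and \<open>ends\<close> is the identity. The plane is
  \<^typ>\<open>complex\<close>.
\<close>

definition simple_graph :: "'v set \<Rightarrow> 'v set set \<Rightarrow> bool" where
  "simple_graph V E \<longleftrightarrow> finite V \<and> (\<forall>e\<in>E. e \<subseteq> V \<and> card e = 2)"

text \<open>
  Edges are arbitrary (not necessarily straight or polygonal) simple arcs. An arc meets the
  vertex points only in its own endpoints, and two arcs meet only in common endpoints.
\<close>

definition plane_embedding ::
  "'v set \<Rightarrow> 'e set \<Rightarrow> ('e \<Rightarrow> 'v set) \<Rightarrow> ('v \<Rightarrow> complex) \<Rightarrow> ('e \<Rightarrow> real \<Rightarrow> complex) \<Rightarrow> bool" where
  "plane_embedding V E ends p \<gamma> \<longleftrightarrow>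
     inj_on p V \<and>
     (\<forall>e\<in>E. ends e \<subseteq> V \<and> arc (\<gamma> e) \<and>
        {pathstart (\<gamma> e), pathfinish (\<gamma> e)} = p ` ends e \<and>
        path_image (\<gamma> e) \<inter> p ` V = p ` ends e) \<and>
     (\<forall>e\<in>E. \<forall>f\<in>E. e \<noteq> f \<longrightarrow>
        path_image (\<gamma> e) \<inter> path_image (\<gamma> f) \<subseteq> p ` (ends e \<inter> ends f))"

definition planar :: "'v set \<Rightarrow> 'v set set \<Rightarrow> bool" where
  "planar V E \<longleftrightarrow> (\<exists>p \<gamma>. plane_embedding V E (\<lambda>e. e) p \<gamma>)"

definition planar_triangulation :: "'v set \<Rightarrow> 'v set set \<Rightarrow> bool" where
  "planar_triangulation V E \<longleftrightarrow>
     simple_graph V E \<and> planar V E \<and>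
     (\<forall>e. e \<subseteq> V \<and> card e = 2 \<and> e \<notin> E \<longrightarrow> \<not> planar V (insert e E))"

definition drawing ::
  "'v set \<Rightarrow> 'e set \<Rightarrow> ('v \<Rightarrow> complex) \<Rightarrow> ('e \<Rightarrow> real \<Rightarrow> complex) \<Rightarrow> complex set" where
  "drawing V E p \<gamma> = p ` V \<union> (\<Union>e\<in>E. path_image (\<gamma> e))"

definition faces ::
  "'v set \<Rightarrow> 'e set \<Rightarrow> ('v \<Rightarrow> complex) \<Rightarrow> ('e \<Rightarrow> real \<Rightarrow> complex) \<Rightarrow> complex set set" where
  "faces V E p \<gamma> = components (- drawing V E p \<gamma>)"

definition boundary_edges :: "'e set \<Rightarrow> ('e \<Rightarrow> real \<Rightarrow> complex) \<Rightarrow> complex set \<Rightarrow> 'e set" where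
  "boundary_edges E \<gamma> F = {e \<in> E. path_image (\<gamma> e) \<subseteq> frontier F}"

text \<open>
  The midpoint of a drawn edge is taken with respect to the parametrisation of its arc. For a
  straight edge \<open>linepath a b\<close> this is the usual midpoint; as the parametrisation is
  arbitrary, it may be any interior point of the arc.
\<close>

definition edge_midpoint :: "('e \<Rightarrow> real \<Rightarrow> complex) \<Rightarrow> 'e \<Rightarrow> complex" where
  "edge_midpoint \<gamma> e = \<gamma> e (1/2)"

text \<open>
  The conjugated triangulation has points of the plane as vertices. An edge is a pair \<open>(F, S)\<close>
  of the bounded face \<open>F\<close> in which it is drawn and the set \<open>S\<close> of its two endpoints, so its
  \<open>ends\<close> map is \<^const>\<open>snd\<close>.
\<close>

definition conj_verts :: "'e set \<Rightarrow> ('e \<Rightarrow> real \<Rightarrow> complex) \<Rightarrow> complex set" where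
  "conj_verts E \<gamma> = edge_midpoint \<gamma> ` E"

definition conj_edges ::
  "'v set \<Rightarrow> 'e set \<Rightarrow> ('v \<Rightarrow> complex) \<Rightarrow> ('e \<Rightarrow> real \<Rightarrow> complex)
     \<Rightarrow> (complex set \<times> complex set) set" where
  "conj_edges V E p \<gamma> =
     {(F, {edge_midpoint \<gamma> e, edge_midpoint \<gamma> f}) | F e f.
        F \<in> faces V E p \<gamma> \<and> bounded F \<and>
        e \<in> boundary_edges E \<gamma> F \<and> f \<in> boundary_edges E \<gamma> F \<and> e \<noteq> f}"

text \<open>
  The arcs \<open>\<delta>\<close> draw the conjugated triangulation: they form a plane embedding (each vertex being
  its own position), and the arc of \<open>(F, S)\<close> runs inside \<open>F\<close> except for its two endpoints.
\<close>

definition conj_drawing ::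
  "'v set \<Rightarrow> 'e set \<Rightarrow> ('v \<Rightarrow> complex) \<Rightarrow> ('e \<Rightarrow> real \<Rightarrow> complex)
     \<Rightarrow> (complex set \<times> complex set \<Rightarrow> real \<Rightarrow> complex) \<Rightarrow> bool" where
  "conj_drawing V E p \<gamma> \<delta> \<longleftrightarrow>
     plane_embedding (conj_verts E \<gamma>) (conj_edges V E p \<gamma>) snd (\<lambda>x. x) \<delta> \<and>
     (\<forall>(F, S) \<in> conj_edges V E p \<gamma>. path_image (\<delta> (F, S)) - S \<subseteq> F)"

definition external_vertex ::
  "'v set \<Rightarrow> 'e set \<Rightarrow> ('v \<Rightarrow> complex) \<Rightarrow> ('e \<Rightarrow> real \<Rightarrow> complex) \<Rightarrow> 'v \<Rightarrow> bool" where
  "external_vertex V E p \<gamma> v \<longleftrightarrow>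
     v \<in> V \<and> (\<exists>F \<in> faces V E p \<gamma>. \<not> bounded F \<and> p v \<in> frontier F)"

definition inner_vertex ::
  "'v set \<Rightarrow> 'e set \<Rightarrow> ('v \<Rightarrow> complex) \<Rightarrow> ('e \<Rightarrow> real \<Rightarrow> complex) \<Rightarrow> 'v \<Rightarrow> bool" where
  "inner_vertex V E p \<gamma> v \<longleftrightarrow> v \<in> V \<and> \<not> external_vertex V E p \<gamma> v"

text \<open>
  A closed walk is given by its cyclic list \<open>vs\<close> of vertices (the starting vertex is not repeated
  at the end) and its list \<open>es\<close> of edges, where \<open>es ! i\<close> leads from \<open>vs ! i\<close> to the cyclically
  next vertex. The walk thus passes \<open>count_list vs v\<close> times through \<open>v\<close>.
\<close>

definition closed_walk :: "'e set \<Rightarrow> ('e \<Rightarrow> 'v set) \<Rightarrow> 'v list \<Rightarrow> 'e list \<Rightarrow> bool" where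
  "closed_walk E ends vs es \<longleftrightarrow>
     es \<noteq> [] \<and> length vs = length es \<and> set es \<subseteq> E \<and>
     (\<forall>i<length es. ends (es ! i) = {vs ! i, vs ! (Suc i mod length es)})"

definition eulerian_circuit :: "'e set \<Rightarrow> ('e \<Rightarrow> 'v set) \<Rightarrow> 'v list \<Rightarrow> 'e list \<Rightarrow> bool" where
  "eulerian_circuit E ends vs es \<longleftrightarrow>
     closed_walk E ends vs es \<and> (\<forall>e\<in>E. count_list es e = 1)"

end

theory Submission
  imports Defs
begin

text \<open>
  If two vertices lie on the frontier of a common face, an arc through that face can be added
  after a local redrawing, so by maximality they are adjacent. A face cannot have four pairwise
  adjacent vertices on its frontier, since a chord of a four-cycle separates the two other
  vertices from each other on its side of the cycle, and the same would hold for the face in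
  place of one of the chords. On the other hand a face has at least three boundary edges, since two
  arcs with at most one common point do not separate the plane. Hence every face is bounded by
  a triangle, and every edge lies on exactly two faces. So \<open>H\<close> is an edge-disjoint union of
  triangles, one for each bounded face. These are linked to each other at midpoints of edges, because the
  inside of the outer triangle remains connected when finitely many vertices are removed, and an
  Eulerian circuit arises by splicing in one triangle after the other. An inner
  midpoint lies on two bounded faces and thus has degree four.
\<close>

subsection \<open>Arcs and Jordan curves\<close>

text \<open>The edges are arbitrary arcs, so nothing is given near them: not that an edge has two
  local sides, and not that a vertex can be reached from a face by an arc. Two-sidedness is obtained
  by closing up a piece of the edge to a Jordan curve and confining its two sides to a small disc by
  Janiszewski's theorem.

  Connectedness of the graph is not given either. Until the boundary of a face is known to be a
  triangle, a frontier may contain isolated vertices, and both local sides of an edge may belong to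
  one face; the lemmas on frontiers allow for both.

  The clique argument is a pigeonhole: a face and the two open diagonals of a four-cycle are three
  connected sets off the cycle, which has only two sides, and no two of them fit on the same side.
  The splitting of the inside by a chord is carried over to the outside by an inversion. The
  triangle comes out of a count: at most three frontier vertices span at least three boundary
  edges.\<close>

text \<open>Janiszewski's theorem: if neither the curve nor \<open>T \<union> sphere x e\<close>
  separates \<open>y\<close> from \<open>z\<close>, and the two sets meet in the connected set
  \<open>T\<close>, then their union does not separate them either. Here \<open>T\<close> is what
  remains of the curve after a small piece around \<open>x\<close> is cut away, and the sphere keeps
  the connecting set in the disc.\<close>

lemma jordan_curve_locally_two_sided:
  fixes c :: "real \<Rightarrow> complex"
  assumes c: "simple_path c" "pathfinish c = pathstart c" and x: "x \<in> path_image c" and "0 < \<epsilon>"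
  obtains \<delta> where "0 < \<delta>"
    "\<And>y z. y \<in> ball x \<delta> \<Longrightarrow> z \<in> ball x \<delta> \<Longrightarrow> connected_component (- path_image c) y z
       \<Longrightarrow> connected_component (ball x \<epsilon> - path_image c) y z"
proof -
  \<comment> \<open>A loop-free path identifies at most the parameters 0 and 1, so the curve has a
    point \<open>b\<close> other than \<open>x\<close>, and the two points cut it into two
    arcs.\<close>
  have "c 0 \<noteq> c (1/2)"
  proof
    assume "c 0 = c (1/2)"
    moreover have "loop_free c" using c by (simp add: simple_path_def)
    ultimately have "(0::real) = 1/2 \<or> (0::real) = 0 \<and> 1/2 = (1::real) \<or> (0::real) = 1 \<and> 1/2 = (0::real)"
      unfolding loop_free_def by (elim ballE[of _ _ 0] ballE[of _ _ "1/2"]) simp_all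
    then show False by simp
  qed
  moreover have "{c 0, c (1/2)} \<subseteq> path_image c"
    by (auto simp: path_image_def)
  ultimately obtain b where b: "b \<in> path_image c" "b \<noteq> x"
    by auto
  obtain u d where u: "arc u" "pathstart u = x" "pathfinish u = b"
    and d: "arc d" "pathstart d = b" "pathfinish d = x"
    and J: "path_image u \<union> path_image d = path_image c"
    using exists_double_arc[OF c x b(1)] b(2) by metis
  define e where "e = min \<epsilon> (dist x b)"
  have e: "0 < e" "e \<le> \<epsilon>" "e \<le> dist x b"
    using b \<open>0 < \<epsilon>\<close> by (auto simp: e_def)
  \<comment> \<open>Cutting an arc shortly after \<open>x\<close> leaves a tail \<open>T\<close> off
    \<open>x\<close>; the piece cut away stays in the disc. The tails of both arcs contain
    \<open>b\<close>, so their union is connected.\<close>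
  have split: "\<exists>T. compact T \<and> connected T \<and> b \<in> T \<and> x \<notin> T \<and> T \<subseteq> path_image g \<and>
                   path_image g \<subseteq> ball x e \<union> T \<and> T \<inter> ball x e \<noteq> {}"
    if g: "arc g" "pathstart g = x" "pathfinish g = b" for g
  proof -
    have cont: "continuous_on {0..1} g"
      using g by (simp add: arc_def path_def)
    then obtain s where s: "0 < s" "\<And>t. t \<in> {0..1} \<Longrightarrow> dist t 0 < s \<Longrightarrow> dist (g t) (g 0) < e"
      using \<open>0 < e\<close> unfolding continuous_on_iff by (metis atLeastAtMost_iff order.refl zero_le_one)
    define s' where "s' = min (s/2) (1/2)"
    have s': "0 < s'" "s' < 1" "s' < s" using s by (auto simp: s'_def)
    have g0: "g 0 = x" "g 1 = b" using g by (auto simp: pathstart_def pathfinish_def)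
    have near: "g t \<in> ball x e" if "0 \<le> t" "t \<le> s'" for t
      using s(2)[of t] that s' g0 by (auto simp: dist_commute)
    show ?thesis
    proof (intro exI conjI)
      show "compact (g ` {s'..1})" "connected (g ` {s'..1})"
        using cont s' by (auto intro!: compact_continuous_image connected_continuous_image
            elim!: continuous_on_subset)
      show "b \<in> g ` {s'..1}" using g0 s' by auto
      show "x \<notin> g ` {s'..1}"
      proof
        assume "x \<in> g ` {s'..1}"
        then obtain t where t: "s' \<le> t" "t \<le> 1" "g t = g 0" using g0 by auto
        have "inj_on g {0..1}" using g(1) by (simp add: arc_def)
        then have "t = 0" using inj_onD[of g "{0..1}" t 0] t s' by auto
        with t s' show False by simp
      qed
      show "g ` {s'..1} \<subseteq> path_image g" using s' by (auto simp: path_image_def)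
      show "path_image g \<subseteq> ball x e \<union> g ` {s'..1}"
      proof
        fix y assume "y \<in> path_image g"
        then obtain t where "0 \<le> t" "t \<le> 1" "y = g t" by (auto simp: path_image_def)
        then show "y \<in> ball x e \<union> g ` {s'..1}"
          using near[of t] by (cases "t \<le> s'") simp_all
      qed
      show "g ` {s'..1} \<inter> ball x e \<noteq> {}"
      proof -
        have "g s' \<in> g ` {s'..1}" using s' by simp
        then show ?thesis using near[of s'] s' by (metis IntI empty_iff less_imp_le order.refl)
      qed
    qed
  qed
  obtain T1 where T1: "compact T1" "connected T1" "b \<in> T1" "x \<notin> T1" "T1 \<subseteq> path_image u"
      "path_image u \<subseteq> ball x e \<union> T1" "T1 \<inter> ball x e \<noteq> {}"
    using split[OF u] by blast
  obtain T2 where T2: "compact T2" "connected T2" "b \<in> T2" "x \<notin> T2" "T2 \<subseteq> path_image d"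
      "path_image d \<subseteq> ball x e \<union> T2"
    using split[of "reversepath d"] d by (auto simp: arc_reversepath)
  define T where "T = T1 \<union> T2"
  have T: "compact T" "connected T" "x \<notin> T" "T \<subseteq> path_image c" "path_image c \<subseteq> ball x e \<union> T"
    using T1 T2 J unfolding T_def by (auto intro: connected_Un)
  have "b \<notin> ball x e" using e by (auto simp: dist_commute)
  then have "T1 \<inter> frontier (ball x e) \<noteq> {}"
    using T1 by (intro connected_Int_frontier) auto
  then have "T \<inter> sphere x e \<noteq> {}"
    using e by (auto simp: T_def frontier_ball)
  then have conn: "connected (T \<union> sphere x e)"
    using T(2) by (intro connected_Un) (auto intro: connected_sphere)
  obtain \<delta>0 where \<delta>0: "0 < \<delta>0" "\<And>y. y \<in> T \<Longrightarrow> \<delta>0 \<le> dist x y"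
    using separate_point_closed[of T x] T by (metis compact_imp_closed)
  define \<delta> where "\<delta> = min \<delta>0 e"
  show thesis
  proof
    show "0 < \<delta>" using \<delta>0 e by (simp add: \<delta>_def)
    fix y z assume yz: "y \<in> ball x \<delta>" "z \<in> ball x \<delta>" and cyz: "connected_component (- path_image c) y z"
    have disj: "ball x \<delta> \<inter> (T \<union> sphere x e) = {}"
      using \<delta>0 by (force simp: \<delta>_def)
    have c2: "connected_component (- (T \<union> sphere x e)) y z"
      unfolding connected_component_def
      using yz disj by (intro exI[of _ "ball x \<delta>"]) auto
    have I: "path_image c \<inter> (T \<union> sphere x e) = T"
      using T by auto
    have "connected_component (- (path_image c \<union> (T \<union> sphere x e))) y z"
    proof (rule Janiszewski)
      show "compact (path_image c)" by (simp add: c compact_simple_path_image)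
      show "closed (T \<union> sphere x e)" using T by (simp add: compact_imp_closed closed_Un)
      show "connected (path_image c \<inter> (T \<union> sphere x e))" using I T by simp
    qed (use cyz c2 in auto)
    then obtain W where W: "connected W" "W \<subseteq> - (path_image c \<union> (T \<union> sphere x e))" "y \<in> W" "z \<in> W"
      unfolding connected_component_def by blast
    have "W \<subseteq> ball x e"
    proof (rule ccontr)
      assume "\<not> W \<subseteq> ball x e"
      moreover have "y \<in> W \<inter> ball x e" using W yz by (auto simp: \<delta>_def)
      ultimately have "W \<inter> frontier (ball x e) \<noteq> {}"
        using W by (intro connected_Int_frontier) auto
      then show False using W e by (auto simp: frontier_ball)
    qed
    then show "connected_component (ball x \<epsilon> - path_image c) y z"
      unfolding connected_component_def using W e by (intro exI[of _ W]) auto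
  qed
qed

text \<open>The arc is homeomorphic to a real interval and hence maps injectively and continuously
  into a segment of the plane. By invariance of domain its interior has an open image there, but a
  segment has empty interior.\<close>

lemma interior_arc_image_empty:
  fixes g :: "real \<Rightarrow> complex"
  assumes "arc g"
  shows "interior (path_image g) = {}"
proof -
  obtain f :: "real \<Rightarrow> complex" and h where fh: "homeomorphism {0..1} (path_image g) f h"
    using homeomorphic_arc_image_interval[OF assms zero_less_one]
    unfolding homeomorphic_sym[of "path_image g"] unfolding homeomorphic_def by blast
  define k where "k = (\<lambda>z. complex_of_real (h z))"
  have "continuous_on (path_image g) k"
    unfolding k_def using fh by (auto simp: homeomorphism_def intro!: continuous_intros)
  moreover have "inj_on k (path_image g)"
    unfolding k_def inj_on_def using fh by (metis homeomorphism_apply2 of_real_eq_iff)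
  ultimately have "open (k ` interior (path_image g))"
    by (intro invariance_of_domain)
       (auto intro: continuous_on_subset inj_on_subset interior_subset[THEN subsetD])
  moreover have "k ` interior (path_image g) \<subseteq> closed_segment 0 1"
  proof -
    have "h ` interior (path_image g) \<subseteq> {0..1}"
      using fh interior_subset unfolding homeomorphism_def by blast
    then show ?thesis
      unfolding k_def by (force simp: closed_segment_def scaleR_conv_of_real)
  qed
  ultimately have "k ` interior (path_image g) \<subseteq> interior (closed_segment 0 (1::complex))"
    by (rule interior_maximal[rotated])
  then show ?thesis
    by (simp add: interior_closed_segment_ge2)
qed

text \<open>A given point \<open>u\<close> of an arc need not be the end of a straight segment from
  the complement, but points arbitrarily close to it are: choose \<open>w\<close> off the arc within
  \<open>r\<close> of \<open>u\<close> and let \<open>a\<close> be a point of the arc nearest to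
  \<open>w\<close>. The bound \<open>2 * r\<close> is the triangle inequality.\<close>

lemma arc_end_accessible:
  fixes g :: "real \<Rightarrow> complex"
  assumes g: "arc g" and "u \<in> path_image g" "0 < r"
  obtains w a where "a \<in> path_image g" "dist u a < 2 * r" "w \<notin> path_image g"
     "closed_segment w a \<inter> path_image g = {a}"
proof -
  have "interior (path_image g) = {}"
    using g by (rule interior_arc_image_empty)
  then have "\<not> ball u r \<subseteq> path_image g"
    using \<open>0 < r\<close> by (metis centre_in_ball empty_iff interior_maximal open_ball subsetD)
  then obtain w where w: "w \<in> ball u r" "w \<notin> path_image g" by blast
  obtain a where a: "a \<in> path_image g" "\<And>y. y \<in> path_image g \<Longrightarrow> dist w a \<le> dist w y"
    using distance_attains_inf[of "path_image g" w] g closed_arc_image by (metis path_image_nonempty ex_in_conv)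
  show thesis
  proof
    show "a \<in> path_image g" "w \<notin> path_image g" by fact+
    have "dist u a \<le> dist u w + dist w a" by (rule dist_triangle)
    also have "\<dots> \<le> dist u w + dist w u" using a(2)[of u] assms(2) by simp
    finally show "dist u a < 2 * r" using w by (simp add: dist_commute)
    show "closed_segment w a \<inter> path_image g = {a}"
    proof -
      have "y = a" if "y \<in> closed_segment w a" "y \<in> path_image g" for y
      proof -
        have "dist w a = dist w y + dist y a" using that between between_mem_segment by metis
        moreover have "dist w a \<le> dist w y" using a that by auto
        ultimately have "dist y a \<le> 0" by linarith
        then show ?thesis by simp
      qed
      then show ?thesis using a(1) by auto
    qed
  qed
qed

text \<open>The complement of an arc is path-connected, so a middle piece of \<open>g\<close> around
  \<open>g t\<close> can be closed up to a Jordan curve \<open>c\<close> by a detour that misses the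
  rest of \<open>g\<close>. Near \<open>g t\<close> the two coincide, and the inside and the outside
  of \<open>c\<close> yield \<open>A\<close> and \<open>B\<close>.\<close>

lemma arc_locally_two_sided:
  fixes g :: "real \<Rightarrow> complex"
  assumes g: "arc g" and t: "0 < t" "t < 1" and "0 < \<epsilon>"
  obtains \<delta> A B where "0 < \<delta>" "connected A" "connected B"
    "A \<subseteq> ball (g t) \<epsilon> - path_image g" "B \<subseteq> ball (g t) \<epsilon> - path_image g"
    "ball (g t) \<delta> - path_image g \<subseteq> A \<union> B"
    "path_image g \<inter> ball (g t) \<delta> \<subseteq> closure A \<inter> closure B"
proof -
  have cont: "continuous_on {0..1} g" and inj: "inj_on g {0..1}"
    using g by (auto simp: arc_def path_def)
  have gne: "g a \<noteq> g b" if "a \<in> {0..1}" "b \<in> {0..1}" "a \<noteq> b" for a b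
    using inj that by (auto simp: inj_on_def)
  have cl: "closed (g ` {a..b})" if "0 \<le> a" "b \<le> 1" for a b
    using cont that by (intro compact_imp_closed compact_continuous_image)
        (auto elim!: continuous_on_subset)
  have off: "g z \<notin> g ` {x..y}" if "0 \<le> x" "y \<le> 1" "z < x \<or> y < z" "0 \<le> z" "z \<le> 1" for x y z
  proof
    assume "g z \<in> g ` {x..y}"
    then obtain u where u: "x \<le> u" "u \<le> y" "g z = g u" by auto
    then show False using gne[of z u] that by auto
  qed
  have "g 0 \<notin> g ` {t..1}" "g 1 \<notin> g ` {0..t}"
    using t by (intro off; simp)+
  then obtain r1 r2 where r12: "0 < r1" "\<And>y. y \<in> g ` {t..1} \<Longrightarrow> r1 \<le> dist (g 0) y"
      "0 < r2" "\<And>y. y \<in> g ` {0..t} \<Longrightarrow> r2 \<le> dist (g 1) y"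
    using separate_point_closed cl t by (metis less_imp_le order.refl)
  \<comment> \<open>Half, since the accessible point lies within \<open>2 * r\<close> of the
    endpoint: this puts \<open>a\<close> before the parameter \<open>t\<close> and \<open>b\<close>
    after it.\<close>
  define r where "r = min r1 r2 / 2"
  have r: "0 < r" "2 * r \<le> r1" "2 * r \<le> r2" using r12 by (auto simp: r_def)
  obtain w a where w: "a \<in> path_image g" "dist (g 0) a < 2 * r" "w \<notin> path_image g"
     "closed_segment w a \<inter> path_image g = {a}"
    using arc_end_accessible[OF g _ r(1), of "g 0"] pathstart_in_path_image[of g]
    unfolding pathstart_def by metis
  obtain w' b where w': "b \<in> path_image g" "dist (g 1) b < 2 * r" "w' \<notin> path_image g"
     "closed_segment w' b \<inter> path_image g = {b}"
    using arc_end_accessible[OF g _ r(1), of "g 1"] pathfinish_in_path_image[of g]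
    unfolding pathfinish_def by metis
  obtain \<alpha> where \<alpha>: "a = g \<alpha>" "0 \<le> \<alpha>" "\<alpha> \<le> 1" using w by (auto simp: path_image_def)
  obtain \<beta> where \<beta>: "b = g \<beta>" "0 \<le> \<beta>" "\<beta> \<le> 1" using w' by (auto simp: path_image_def)
  have "\<alpha> < t"
  proof (rule ccontr)
    assume "\<not> \<alpha> < t"
    then have "a \<in> g ` {t..1}" using \<alpha> by auto
    then show False using r12(2)[of a] w(2) r by linarith
  qed
  have "t < \<beta>"
  proof (rule ccontr)
    assume "\<not> t < \<beta>"
    then have "b \<in> g ` {0..t}" using \<beta> by auto
    then show False using r12(4)[of b] w'(2) r by linarith
  qed
  have "path_connected (- path_image g)"
    using g by (simp add: path_connected_arc_complement)
  then obtain q where q: "path q" "path_image q \<subseteq> - path_image g" "pathstart q = w" "pathfinish q = w'"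
    using w(3) w'(3) unfolding path_connected_def by (meson ComplI)
  define m where "m = linepath a w +++ q +++ linepath w' b"
  have m: "path m" "pathstart m = a" "pathfinish m = b"
    using q by (auto simp: m_def)
  have "path_image m = closed_segment w a \<union> path_image q \<union> closed_segment w' b"
    using q by (auto simp: m_def path_image_join closed_segment_commute)
  then have mg: "path_image m \<inter> path_image g = {a, b}"
    using w w' q by auto
  have "a \<noteq> b" using \<alpha> \<beta> gne \<open>\<alpha> < t\<close> \<open>t < \<beta>\<close> by auto
  then obtain n where n: "arc n" "path_image n \<subseteq> path_image m" "pathstart n = a" "pathfinish n = b"
    using path_contains_arc[OF m] by metis
  define s where "s = subpath \<alpha> \<beta> g"
  have "\<alpha> < \<beta>" using \<open>\<alpha> < t\<close> \<open>t < \<beta>\<close> by simp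
  have s: "arc s" "pathstart s = a" "pathfinish s = b" "path_image s = g ` {\<alpha>..\<beta>}"
    using g \<alpha> \<beta> \<open>\<alpha> < \<beta>\<close>
    by (auto simp: s_def path_image_subpath intro!: arc_subpath_arc)
  have sg: "path_image s \<subseteq> path_image g"
    using s(4) \<alpha> \<beta> by (auto simp: path_image_def)
  define c where "c = s +++ reversepath n"
  have c: "simple_path c" "pathfinish c = pathstart c"
  proof -
    have "path_image s \<inter> path_image (reversepath n) \<subseteq> {pathstart s, pathstart (reversepath n)}"
      using s(2,3) n(2-4) sg mg by (simp, blast)
    then show "simple_path c"
      unfolding c_def using s n by (intro simple_path_join_loop) (simp_all add: arc_reversepath)
    show "pathfinish c = pathstart c"
      unfolding c_def using s n by simp
  qed
  have pc: "path_image c = g ` {\<alpha>..\<beta>} \<union> path_image n"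
    unfolding c_def using s n by (simp add: path_image_join)
  \<comment> \<open>\<open>X\<close> collects all points where \<open>c\<close> and \<open>g\<close>
    can differ: the two discarded ends of \<open>g\<close> and the detour \<open>n\<close>. In a
    disc around \<open>g t\<close> that misses \<open>X\<close> they coincide.\<close>
  define X where "X = g ` {0..\<alpha>} \<union> g ` {\<beta>..1} \<union> path_image n"
  have "closed X" unfolding X_def using cl \<alpha> \<beta> n by (intro closed_Un) (auto simp: closed_arc_image)
  moreover have "g t \<notin> X"
  proof -
    have "g t \<notin> g ` {0..\<alpha>}" "g t \<notin> g ` {\<beta>..1}"
      using \<open>\<alpha> < t\<close> \<open>t < \<beta>\<close> \<alpha> \<beta> t by (intro off; simp)+
    moreover have "g t \<noteq> a" "g t \<noteq> b"
      using calculation \<alpha> \<beta> by auto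
    moreover have "g t \<in> path_image g" using t by (simp add: path_image_def)
    then have "g t \<notin> path_image n"
      using n(2) mg \<open>g t \<noteq> a\<close> \<open>g t \<noteq> b\<close> by blast
    ultimately show ?thesis by (auto simp: X_def)
  qed
  ultimately obtain \<epsilon>0 where \<epsilon>0: "0 < \<epsilon>0" "\<And>y. y \<in> X \<Longrightarrow> \<epsilon>0 \<le> dist (g t) y"
    using separate_point_closed by metis
  define e where "e = min \<epsilon> \<epsilon>0"
  have e: "0 < e" "e \<le> \<epsilon>" "ball (g t) e \<inter> X = {}"
    using \<epsilon>0(1) \<open>0 < \<epsilon>\<close> by (auto simp: e_def dest!: \<epsilon>0(2))
  have parts: "path_image g \<subseteq> g ` {0..\<alpha>} \<union> g ` {\<alpha>..\<beta>} \<union> g ` {\<beta>..1}"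
  proof -
    have "{0..1} \<subseteq> {0..\<alpha>} \<union> {\<alpha>..\<beta>} \<union> {\<beta>..1}" by auto
    then show ?thesis unfolding path_image_def by (metis image_Un image_mono)
  qed
  have same: "ball (g t) e' \<inter> path_image c = ball (g t) e' \<inter> path_image g" if "e' \<le> e" for e'
  proof -
    have "ball (g t) e' \<inter> X = {}" using that e(3) subset_ball[OF that, of "g t"] by blast
    then show ?thesis
      using parts sg s(4) unfolding pc X_def by blast
  qed
  have tc: "g t \<in> path_image c" using pc \<open>\<alpha> < t\<close> \<open>t < \<beta>\<close> by auto
  obtain \<delta>0 where \<delta>0: "0 < \<delta>0" "\<And>y z. y \<in> ball (g t) \<delta>0 \<Longrightarrow> z \<in> ball (g t) \<delta>0 \<Longrightarrow>
      connected_component (- path_image c) y z \<Longrightarrow> connected_component (ball (g t) e - path_image c) y z"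
    using jordan_curve_locally_two_sided[OF c tc \<open>0 < e\<close>] by metis
  define \<delta> where "\<delta> = min \<delta>0 e"
  have \<delta>: "0 < \<delta>" "\<delta> \<le> e" "\<delta> \<le> \<delta>0" using \<delta>0 e by (auto simp: \<delta>_def)
  have J: "connected (inside (path_image c))" "connected (outside (path_image c))"
    "inside (path_image c) \<union> outside (path_image c) = - path_image c"
    "frontier (inside (path_image c)) = path_image c" "frontier (outside (path_image c)) = path_image c"
    using Jordan_inside_outside[OF c] by simp_all
  \<comment> \<open>Either component \<open>S\<close> of the complement of \<open>c\<close>
    accumulates at \<open>g t\<close>, and by the local two-sidedness its trace near
    \<open>g t\<close> lies in a single component \<open>A\<close> of the small disc minus the
    curve.\<close>
  have side: "\<exists>A. connected A \<and> A \<subseteq> ball (g t) \<epsilon> - path_image g \<and> S \<inter> ball (g t) \<delta> \<subseteq> A \<and>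
      path_image g \<inter> ball (g t) \<delta> \<subseteq> closure A"
    if S: "connected S" "S \<inter> path_image c = {}" "frontier S = path_image c" for S
  proof -
    have "g t \<in> closure S" using S tc by (auto simp: frontier_def)
    then obtain y where y: "y \<in> S" "y \<in> ball (g t) \<delta>"
      using \<delta> by (metis closure_approachable dist_commute mem_ball)
    define A where "A = connected_component_set (ball (g t) e - path_image c) y"
    have sub: "S \<inter> ball (g t) \<delta> \<subseteq> A"
    proof
      fix z assume z: "z \<in> S \<inter> ball (g t) \<delta>"
      have "connected_component (- path_image c) y z"
        unfolding connected_component_def using S y z by (intro exI[of _ S]) auto
      then show "z \<in> A" using \<delta>0(2)[of y z] y z \<delta> by (auto simp: A_def)
    qed
    have "A \<subseteq> ball (g t) e - path_image c" unfolding A_def by (rule connected_component_subset)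
    then have 1: "A \<subseteq> ball (g t) \<epsilon> - path_image g"
      using same[OF order.refl] subset_ball[OF e(2), of "g t"] by blast
    have 2: "path_image g \<inter> ball (g t) \<delta> \<subseteq> closure A"
    proof
      fix z assume z: "z \<in> path_image g \<inter> ball (g t) \<delta>"
      then have "z \<in> path_image c" using same[OF \<delta>(2)] by blast
      then have "z \<in> closure S" using S by (auto simp: frontier_def)
      then have "z \<in> closure (ball (g t) \<delta> \<inter> S)"
        using z open_Int_closure_subset[of "ball (g t) \<delta>" S] by blast
      then show "z \<in> closure A" using sub closure_mono by (metis Int_commute subsetD)
    qed
    have "connected A" by (simp add: A_def)
    then show ?thesis using sub 1 2 by blast
  qed
  have fi: "inside (path_image c) \<inter> path_image c = {}" "outside (path_image c) \<inter> path_image c = {}"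
    by (simp_all add: inside_no_overlap outside_no_overlap)
  obtain A where A: "connected A" "A \<subseteq> ball (g t) \<epsilon> - path_image g" "inside (path_image c) \<inter> ball (g t) \<delta> \<subseteq> A"
      "path_image g \<inter> ball (g t) \<delta> \<subseteq> closure A"
    using side[OF J(1) fi(1) J(4)] by blast
  obtain B where B: "connected B" "B \<subseteq> ball (g t) \<epsilon> - path_image g" "outside (path_image c) \<inter> ball (g t) \<delta> \<subseteq> B"
      "path_image g \<inter> ball (g t) \<delta> \<subseteq> closure B"
    using side[OF J(2) fi(2) J(5)] by blast
  show thesis
  proof
    show "ball (g t) \<delta> - path_image g \<subseteq> A \<union> B"
    proof
      fix z assume z: "z \<in> ball (g t) \<delta> - path_image g"
      then have "z \<in> - path_image c" using same[OF \<delta>(2)] by blast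
      then have "z \<in> inside (path_image c) \<or> z \<in> outside (path_image c)" using J(3) by blast
      then show "z \<in> A \<union> B" using A(3) B(3) z by blast
    qed
    show "path_image g \<inter> ball (g t) \<delta> \<subseteq> closure A \<inter> closure B"
      using A(4) B(4) by blast
  qed (fact \<delta>(1) A B)+
qed

section \<open>Chords of a Jordan curve\<close>

text \<open>The chord divides the inside into the insides of \<open>c1\<close> with \<open>c\<close>
  and of \<open>c2\<close> with \<open>c\<close>. A connected \<open>W\<close> off all three arcs
  lies in one of them, and the closure of each misses the open arc on the other side, so
  \<open>W\<close> cannot approach both \<open>u\<close> and \<open>w\<close>.\<close>

lemma chord_splits_inside:
  fixes c :: "real \<Rightarrow> complex"
  assumes c1: "arc c1" "pathstart c1 = a" "pathfinish c1 = b"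
    and c2: "arc c2" "pathstart c2 = a" "pathfinish c2 = b"
    and c: "arc c" "pathstart c = a" "pathfinish c = b"
    and meet: "path_image c1 \<inter> path_image c2 = {a, b}" "path_image c1 \<inter> path_image c = {a, b}"
      "path_image c2 \<inter> path_image c = {a, b}"
    and c_in: "path_image c \<inter> inside (path_image c1 \<union> path_image c2) \<noteq> {}"
    and W: "connected W" "W \<inter> (path_image c1 \<union> path_image c2 \<union> path_image c) = {}"
      "W \<inter> inside (path_image c1 \<union> path_image c2) \<noteq> {}"
    and u: "u \<in> path_image c1 - {a, b}" "u \<in> closure W"
    and w: "w \<in> path_image c2 - {a, b}" "w \<in> closure W"
  shows False
proof -
  let ?J = "path_image c1 \<union> path_image c2"
  let ?O1 = "inside (path_image c1 \<union> path_image c)" and ?O2 = "inside (path_image c2 \<union> path_image c)"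
  have "a \<noteq> b" using c1 arc_distinct_ends by metis
  have split: "?O1 \<inter> ?O2 = {}" "?O1 \<union> ?O2 \<union> (path_image c - {a, b}) = inside ?J"
    using split_inside_simple_closed_curve[of c1 a b c2 c] arc_imp_simple_path assms \<open>a \<noteq> b\<close> by metis+
  have closed: "closed (path_image c1 \<union> path_image c)" "closed (path_image c2 \<union> path_image c)"
    using c1 c2 c by (simp_all add: closed_Un closed_arc_image)
  have "W \<inter> outside ?J = {}"
    using inside_outside_intersect_connected[OF W(1), of ?J] W(2,3) by blast
  then have "W \<subseteq> inside ?J" using W(2) inside_Un_outside[of ?J] by blast
  then have sub: "W \<subseteq> ?O1 \<union> ?O2" using split(2) W(2) by blast
  have "?O1 \<inter> W = {} \<or> ?O2 \<inter> W = {}"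
    using connectedD[OF W(1), of ?O1 ?O2] sub split(1) closed by (auto simp: open_inside)
  then have "W \<subseteq> ?O1 \<or> W \<subseteq> ?O2" using sub by blast
  then show False
  proof
    assume "W \<subseteq> ?O1"
    then have "w \<in> (path_image c1 \<union> path_image c) \<union> ?O1"
      using w(2) closure_inside_subset[OF closed(1)] closure_mono by blast
    then have "w \<in> inside ?J" using w(1) meet split(2) by blast
    then show False using w(1) inside_no_overlap[of ?J] by blast
  next
    assume "W \<subseteq> ?O2"
    then have "u \<in> (path_image c2 \<union> path_image c) \<union> ?O2"
      using u(2) closure_inside_subset[OF closed(2)] closure_mono by blast
    then have "u \<in> inside ?J" using u(1) meet split(2) by blast
    then show False using u(1) inside_no_overlap[of ?J] by blast
  qed
qed

lemma jordan_curve_of_arcs: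
  fixes c1 c2 :: "real \<Rightarrow> complex"
  assumes "arc c1" "pathstart c1 = a" "pathfinish c1 = b"
    and "arc c2" "pathstart c2 = a" "pathfinish c2 = b"
    and "path_image c1 \<inter> path_image c2 = {a, b}"
  shows "simple_path (c1 +++ reversepath c2)"
    "pathfinish (c1 +++ reversepath c2) = pathstart (c1 +++ reversepath c2)"
    "path_image (c1 +++ reversepath c2) = path_image c1 \<union> path_image c2"
  using assms by (auto simp: arc_reversepath path_image_join intro!: simple_path_join_loop)

text \<open>Inversion turns the inside punctured at \<open>s\<close> into an unbounded connected
  set, which must lie in the outside of the image curve. So a point other than 0 inside the image
  curve can only come from the outside of \<open>c\<close>, and connectedness moves the whole
  outside along with it.\<close>

lemma inversion_maps_outside_to_inside:
  fixes c :: "real \<Rightarrow> complex"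
  defines "f s \<equiv> (\<lambda>z. inverse (z - s))"
  assumes c: "simple_path c" "pathfinish c = pathstart c" and s: "s \<in> inside (path_image c)"
  shows "f s ` outside (path_image c) \<subseteq> inside (f s ` path_image c)"
proof -
  let ?J = "path_image c" and ?f = "f s"
  note jordan = Jordan_inside_outside[OF c]
  have sJ: "s \<notin> ?J" "s \<notin> outside ?J"
    using s inside_no_overlap[of ?J] inside_Int_outside[of ?J] by blast+
  have cont: "continuous_on S ?f" if "s \<notin> S" for S
    unfolding f_def using that by (intro continuous_intros) auto
  \<comment> \<open>On the whole plane: as \<open>inverse 0 = 0\<close>, the centre \<open>s\<close>
    is the one preimage of 0.\<close>
  have inj: "inj ?f" by (auto simp: inj_on_def f_def)
  have surj: "z = ?f (s + inverse z)" "z \<noteq> 0 \<Longrightarrow> s + inverse z \<noteq> s" for z by (auto simp: f_def)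
  have pJ: "path_image (?f \<circ> c) = ?f ` ?J" by (rule path_image_compose)
  have c': "simple_path (?f \<circ> c)" "pathfinish (?f \<circ> c) = pathstart (?f \<circ> c)"
    using c cont[OF sJ(1)] inj
    by (auto simp: pathfinish_compose pathstart_compose
        intro!: simple_path_continuous_image intro: inj_on_subset)
  note jordan' = Jordan_inside_outside[OF c', unfolded pJ]
  have disj: "?f ` S \<inter> ?f ` ?J = {}" if "S \<inter> ?J = {}" for S
    using inj that by (simp add: image_Int[symmetric])
  have in': "connected (?f ` (inside ?J - {s}))"
    using jordan by (intro connected_continuous_image cont connected_open_diff_countable) auto
  have "\<not> bounded (?f ` (inside ?J - {s}))"
  proof
    assume "bounded (?f ` (inside ?J - {s}))"
    then obtain M where M: "0 < M" "\<And>z. z \<in> inside ?J - {s} \<Longrightarrow> norm (?f z) \<le> M"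
      by (auto simp: bounded_pos)
    obtain \<rho> where \<rho>: "0 < \<rho>" "ball s \<rho> \<subseteq> inside ?J"
      using jordan s by (meson open_contains_ball)
    \<comment> \<open>At distance \<open>\<eta>\<close> from \<open>s\<close> a point is still
      inside the curve, while its image has norm \<open>1 / \<eta>\<close>, which exceeds
      \<open>M\<close>.\<close>
    define \<eta> where "\<eta> = min (\<rho> / 2) (1 / (2 * M))"
    have \<eta>: "0 < \<eta>" "\<eta> < \<rho>" "\<eta> < 1 / M"
      using \<rho> M by (auto simp: \<eta>_def min_less_iff_disj field_simps)
    have "s + of_real \<eta> \<in> inside ?J - {s}"
      using \<eta> \<rho> by (auto simp: dist_norm)
    then have "inverse \<eta> \<le> M"
      using M(2)[of "s + of_real \<eta>"] \<eta>(1) by (simp add: f_def norm_inverse)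
    then show False using \<eta> M(1) by (simp add: field_simps)
  qed
  moreover have missed: "?f ` (inside ?J - {s}) \<inter> ?f ` ?J = {}"
    using inside_no_overlap[of ?J] by (intro disj) blast
  moreover have "bounded (inside (?f ` ?J))" using jordan' by blast
  ultimately have "\<not> ?f ` (inside ?J - {s}) \<subseteq> inside (?f ` ?J)"
    using bounded_subset by blast
  then have "?f ` (inside ?J - {s}) \<inter> outside (?f ` ?J) \<noteq> {}"
    using missed inside_Un_outside[of "?f ` ?J"] by fast
  then have in'_out: "?f ` (inside ?J - {s}) \<inter> inside (?f ` ?J) = {}"
    using inside_outside_intersect_connected[OF in', of "?f ` ?J"] missed by (metis inf_commute)
  \<comment> \<open>\<open>in'_out\<close> says nothing about \<open>s\<close>, whose image is 0, so
    a point besides 0 is required; a nonempty open set has one.\<close>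
  have "\<not> inside (?f ` ?J) \<subseteq> {0}"
  proof
    assume "inside (?f ` ?J) \<subseteq> {0}"
    then have "open {0::complex}" using jordan' by (metis subset_singletonD)
    then show False by (simp add: not_open_singleton)
  qed
  then obtain y where y: "y \<in> inside (?f ` ?J)" "y \<noteq> 0" by blast
  define x where "x = s + inverse y"
  have x: "y = ?f x" "x \<noteq> s" using surj y unfolding x_def by auto
  have "x \<notin> ?J" using y x inside_no_overlap[of "?f ` ?J"] by blast
  moreover have "x \<notin> inside ?J"
    using in'_out x y by blast
  ultimately have "x \<in> outside ?J" using inside_Un_outside[of ?J] by blast
  then have "?f ` outside ?J \<inter> inside (?f ` ?J) \<noteq> {}" using x y by blast
  moreover have "connected (?f ` outside ?J)"
    using jordan sJ(2) by (intro connected_continuous_image cont) auto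
  moreover have "?f ` outside ?J \<inter> ?f ` ?J = {}"
    using outside_no_overlap[of ?J] by (intro disj) blast
  ultimately show ?thesis
    using inside_outside_intersect_connected[of "?f ` outside ?J" "?f ` ?J"]
      inside_Un_outside[of "?f ` ?J"] by blast
qed

text \<open>Inversion at a point \<open>s\<close> inside the curve reduces this to
  \<open>chord_splits_inside\<close>. The chord, apart from its ends, and \<open>W\<close> lie
  outside the curve, so both miss \<open>s\<close>, and the inversion is continuous wherever it is
  applied.\<close>

lemma chord_splits_outside:
  fixes c :: "real \<Rightarrow> complex"
  assumes c1: "arc c1" "pathstart c1 = a" "pathfinish c1 = b"
    and c2: "arc c2" "pathstart c2 = a" "pathfinish c2 = b"
    and c: "arc c" "pathstart c = a" "pathfinish c = b"
    and meet: "path_image c1 \<inter> path_image c2 = {a, b}" "path_image c1 \<inter> path_image c = {a, b}"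
      "path_image c2 \<inter> path_image c = {a, b}"
    and c_out: "path_image c \<inter> outside (path_image c1 \<union> path_image c2) \<noteq> {}"
    and W: "connected W" "W \<inter> (path_image c1 \<union> path_image c2 \<union> path_image c) = {}"
      "W \<inter> outside (path_image c1 \<union> path_image c2) \<noteq> {}"
    and u: "u \<in> path_image c1 - {a, b}" "u \<in> closure W"
    and w: "w \<in> path_image c2 - {a, b}" "w \<in> closure W"
  shows False
proof -
  let ?J = "path_image c1 \<union> path_image c2"
  note J = jordan_curve_of_arcs[OF c1 c2 meet(1)]
  obtain s where s: "s \<in> inside ?J"
    using Jordan_inside_outside[OF J(1,2)] J(3) by auto
  have sJ: "s \<notin> ?J" using s inside_no_overlap[of ?J] by blast
  define f where "f = (\<lambda>z. inverse (z - s))"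
  have maps: "f ` outside ?J \<subseteq> inside (f ` ?J)"
    using inversion_maps_outside_to_inside[OF J(1,2), of s] s J(3) unfolding f_def by simp
  have cont: "continuous_on S f" if "s \<notin> S" for S
    unfolding f_def using that by (intro continuous_intros) auto
  have inj: "inj f" by (auto simp: inj_on_def f_def)
  have "connected (path_image c - {a, b})"
    using connected_simple_path_endless[of c] c by (simp add: arc_imp_simple_path)
  moreover have "(path_image c - {a, b}) \<inter> ?J = {}" using meet by blast
  moreover have "(path_image c - {a, b}) \<inter> outside ?J \<noteq> {}"
    using c_out meet(1) outside_no_overlap[of ?J] by blast
  ultimately have "(path_image c - {a, b}) \<inter> inside ?J = {}"
    using inside_outside_intersect_connected[of "path_image c - {a, b}" ?J] by blast
  then have sc: "s \<notin> path_image c" using s sJ meet(1) by blast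
  have "W \<inter> inside ?J = {}"
    using inside_outside_intersect_connected[OF W(1), of ?J] W(2,3) by blast
  then have sW: "s \<notin> W" using s by blast
  have arc_f: "arc (f \<circ> g)" if "arc g" "s \<notin> path_image g" for g
    using that cont inj unfolding arc_def path_image_def
    by (auto intro!: path_continuous_image comp_inj_on intro: inj_on_subset simp: path_image_def)
  have Int_f: "f ` A \<inter> f ` B = f ` (A \<inter> B)" for A B
    using inj by (simp add: image_Int)
  have closure_f: "f z \<in> closure (f ` W)" if z: "z \<in> closure W" "z \<in> ?J" for z
  proof -
    obtain x where x: "\<And>n. x n \<in> W" "x \<longlonglongrightarrow> z" using z(1) by (auto simp: closure_sequential)
    have "z - s \<noteq> 0" using z(2) sJ by auto
    then have "(\<lambda>n. f (x n)) \<longlonglongrightarrow> f z"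
      unfolding f_def using x(2) by (intro tendsto_intros)
    then show ?thesis
      unfolding closure_sequential using x(1) by (intro exI[of _ "\<lambda>n. f (x n)"]) auto
  qed
  have *: "f x \<in> f ` A \<longleftrightarrow> x \<in> A" for x A using inj by (simp add: inj_image_mem_iff)
  show False
  proof (rule chord_splits_inside[of "f \<circ> c1" "f a" "f b" "f \<circ> c2" "f \<circ> c" "f ` W" "f u" "f w"])
    show "arc (f \<circ> c1)" "arc (f \<circ> c2)" "arc (f \<circ> c)" using arc_f c1 c2 c sJ sc by auto
    show "pathstart (f \<circ> c1) = f a" "pathfinish (f \<circ> c1) = f b" "pathstart (f \<circ> c2) = f a"
      "pathfinish (f \<circ> c2) = f b" "pathstart (f \<circ> c) = f a" "pathfinish (f \<circ> c) = f b"
      using c1 c2 c by (simp_all add: pathstart_compose pathfinish_compose)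
    show "path_image (f \<circ> c1) \<inter> path_image (f \<circ> c2) = {f a, f b}"
      "path_image (f \<circ> c1) \<inter> path_image (f \<circ> c) = {f a, f b}"
      "path_image (f \<circ> c2) \<inter> path_image (f \<circ> c) = {f a, f b}"
      using meet by (simp_all add: path_image_compose Int_f)
    show "connected (f ` W)" using W sW by (intro connected_continuous_image cont)
    show "path_image (f \<circ> c) \<inter> inside (path_image (f \<circ> c1) \<union> path_image (f \<circ> c2)) \<noteq> {}"
      using c_out maps by (simp add: path_image_compose image_Un[symmetric]) blast
    show "f ` W \<inter> inside (path_image (f \<circ> c1) \<union> path_image (f \<circ> c2)) \<noteq> {}"
      using W(3) maps by (simp add: path_image_compose image_Un[symmetric]) blast
    show "f ` W \<inter> (path_image (f \<circ> c1) \<union> path_image (f \<circ> c2) \<union> path_image (f \<circ> c)) = {}"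
      using W(2) by (simp add: path_image_compose image_Un[symmetric] Int_f)
    show "f u \<in> closure (f ` W)" "f w \<in> closure (f ` W)" using closure_f u w by auto
    show "f u \<in> path_image (f \<circ> c1) - {f a, f b}" "f w \<in> path_image (f \<circ> c2) - {f a, f b}"
      using u w inj by (auto simp: path_image_compose * inj_eq)
  qed
qed

subsection \<open>Plane graphs and the insertion of an edge\<close>

text \<open>Follow \<open>g\<close> backwards from its end to the first point \<open>q\<close> on
  the circle and continue along the radius. The radius stays in the closed disc and the rest outside
  it except for \<open>q\<close>, so the result is again an arc.\<close>

lemma redirect_arc_to_centre:
  fixes g :: "real \<Rightarrow> complex"
  assumes g: "arc g" "pathstart g \<in> ball c r" "pathfinish g \<notin> cball c r"
  obtains h q where "arc h" "pathstart h = c" "pathfinish h = pathfinish g"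
    "q \<in> sphere c r" "q \<in> path_image g"
    "path_image h \<subseteq> closed_segment c q \<union> (path_image g - cball c r)"
proof -
  have "0 < r" using g(2) by (metis ball_eq_empty empty_iff not_less)
  have "path (reversepath g)" "pathstart (reversepath g) \<in> closure (- cball c r)"
    "pathfinish (reversepath g) \<notin> - cball c r"
    using g closure_subset[of "- cball c r"] by (auto simp: arc_imp_path)
  then obtain k where k: "path k" "pathstart k = pathfinish g" "path_image k \<subseteq> path_image g"
      "path_image k - {pathfinish k} \<subseteq> interior (- cball c r)" "pathfinish k \<in> frontier (- cball c r)"
    by (rule exists_path_subpath_to_frontier) simp
  define q where "q = pathfinish k"
  have q: "q \<in> sphere c r" "q \<in> path_image g"
    using k(3,5) pathfinish_in_path_image[of k] \<open>0 < r\<close>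
    by (auto simp: q_def frontier_complement)
  have kq: "path_image k - {q} \<subseteq> - cball c r"
    using k(4) interior_subset unfolding q_def by blast
  have "q \<noteq> pathfinish g" using q g(3) by auto
  then obtain k' where k': "arc k'" "path_image k' \<subseteq> path_image k" "pathstart k' = q" "pathfinish k' = pathfinish g"
    using path_contains_arc[of "reversepath k" q "pathfinish g"] k q_def by (metis path_image_reversepath
        path_reversepath pathfinish_reversepath pathstart_reversepath)
  have seg: "closed_segment c q \<subseteq> cball c r"
    using q(1) \<open>0 < r\<close> by (intro closed_segment_subset) auto
  define h where "h = linepath c q +++ k'"
  have "c \<noteq> q" using q \<open>0 < r\<close> by auto
  have "closed_segment c q \<inter> path_image k' \<subseteq> {q}"
    using seg kq k'(2) by blast
  then have "arc h"
    unfolding h_def using k' \<open>c \<noteq> q\<close> by (intro arc_join) auto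
  moreover have "path_image h \<subseteq> closed_segment c q \<union> (path_image g - cball c r)"
  proof -
    have "path_image h = closed_segment c q \<union> path_image k'"
      unfolding h_def using k' by (simp add: path_image_join)
    moreover have "path_image k' \<subseteq> closed_segment c q \<union> (path_image g - cball c r)"
      using k'(2) kq k(3) by auto
    ultimately show ?thesis by blast
  qed
  ultimately show thesis
    using that[of h q] q k' by (simp add: h_def)
qed

text \<open>Keeps redrawn arcs apart within a disc. As both radii have the same length, the norm of
  \<open>z - c\<close> determines the factor by which \<open>q - c\<close> and \<open>q' - c\<close>
  are scaled.\<close>

lemma radii_meet_in_centre:
  fixes c :: complex
  assumes "q \<in> sphere c r" "q' \<in> sphere c r" "z \<in> closed_segment c q" "z \<in> closed_segment c q'" "z \<noteq> c"
  shows "q = q'"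
proof -
  obtain s where s: "z - c = s *\<^sub>R (q - c)" "0 \<le> s"
    using assms(3) by (auto simp: closed_segment_def algebra_simps)
  obtain s' where s': "z - c = s' *\<^sub>R (q' - c)" "0 \<le> s'"
    using assms(4) by (auto simp: closed_segment_def algebra_simps)
  have "norm (q - c) = r" "norm (q' - c) = r"
    using assms(1,2) by (auto simp: dist_norm norm_minus_commute)
  moreover have "norm (z - c) = s * norm (q - c)" "norm (z - c) = s' * norm (q' - c)"
    unfolding s(1) s'(1)[unfolded s(1)] using s(2) arg_cong[OF s'(1), of norm] s'(2) by (simp_all add: s(1))
  ultimately have "s * r = s' * r" by metis
  moreover have "r \<noteq> 0"
    using \<open>norm (q - c) = r\<close> s(1) assms(5) by auto
  ultimately have "s = s'" by simp
  moreover have "s \<noteq> 0" using s(1) assms(5) by auto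
  ultimately show ?thesis using s(1) s'(1) by (metis diff_add_cancel scaleR_cancel_left)
qed

locale plane_graph =
  fixes V :: "'v set" and E :: "'v set set" and p :: "'v \<Rightarrow> complex" and \<gamma> :: "'v set \<Rightarrow> real \<Rightarrow> complex"
  assumes graph: "simple_graph V E" and emb: "plane_embedding V E (\<lambda>e. e) p \<gamma>"
begin

abbreviation "D \<equiv> drawing V E p \<gamma>"
abbreviation "Faces \<equiv> faces V E p \<gamma>"

lemma finite_V: "finite V" and edge_subset: "e \<in> E \<Longrightarrow> e \<subseteq> V" and edge_card: "e \<in> E \<Longrightarrow> card e = 2"
  using graph by (auto simp: simple_graph_def)

lemma finite_E: "finite E"
  using finite_V edge_subset by (meson PowI finite_Pow_iff finite_subset subsetI)

lemma inj_p: "inj_on p V"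
  using emb by (simp add: plane_embedding_def)

lemma edge_arc: "e \<in> E \<Longrightarrow> arc (\<gamma> e)"
  and edge_ends: "e \<in> E \<Longrightarrow> {pathstart (\<gamma> e), pathfinish (\<gamma> e)} = p ` e"
  and edge_verts: "e \<in> E \<Longrightarrow> path_image (\<gamma> e) \<inter> p ` V = p ` e"
  and edge_meet: "e \<in> E \<Longrightarrow> f \<in> E \<Longrightarrow> e \<noteq> f \<Longrightarrow> path_image (\<gamma> e) \<inter> path_image (\<gamma> f) \<subseteq> p ` (e \<inter> f)"
  using emb by (auto simp: plane_embedding_def)

lemma vertex_on_edge: "e \<in> E \<Longrightarrow> v \<in> V \<Longrightarrow> p v \<in> path_image (\<gamma> e) \<longleftrightarrow> v \<in> e"
  using edge_verts[of e] inj_p edge_subset[of e] by (auto simp: inj_on_def)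

lemma other_end:
  assumes "e \<in> E" "v \<in> e" obtains w where "e = {v, w}" "w \<noteq> v" "w \<in> V" "v \<in> V"
  using assms edge_card[OF assms(1)] edge_subset[OF assms(1)] unfolding card_2_iff by blast

text \<open>The embedding determines the two ends of \<open>\<gamma> e\<close> only as a set, so the
  arc may have to be reversed.\<close>

lemma oriented_arc:
  assumes e: "{v, w} \<in> E"
  obtains g where "arc g" "pathstart g = p v" "pathfinish g = p w" "path_image g = path_image (\<gamma> {v, w})"
proof -
  have "{pathstart (\<gamma> {v, w}), pathfinish (\<gamma> {v, w})} = {p v, p w}"
    using edge_ends[OF e] by simp
  then consider "pathstart (\<gamma> {v, w}) = p v" "pathfinish (\<gamma> {v, w}) = p w"
    | "pathstart (\<gamma> {v, w}) = p w" "pathfinish (\<gamma> {v, w}) = p v"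
    by (metis doubleton_eq_iff)
  then show thesis
  proof cases
    case 1
    then show ?thesis using that edge_arc[OF e] by blast
  next
    case 2
    then show ?thesis using that[of "reversepath (\<gamma> {v, w})"] edge_arc[OF e] by (simp add: arc_reversepath)
  qed
qed

lemma compact_D: "compact D"
  unfolding drawing_def
  using finite_V finite_E edge_arc by (intro compact_Un compact_UN) (simp_all add: compact_arc_image finite_imp_compact)

lemma edge_subset_D: "e \<in> E \<Longrightarrow> path_image (\<gamma> e) \<subseteq> D"
  and vertex_in_D: "v \<in> V \<Longrightarrow> p v \<in> D"
  by (auto simp: drawing_def)

lemma face_open: "F \<in> Faces \<Longrightarrow> open F"
  and face_connected: "F \<in> Faces \<Longrightarrow> connected F"
  and face_disjoint: "F \<in> Faces \<Longrightarrow> F \<inter> D = {}"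
  and face_nonempty: "F \<in> Faces \<Longrightarrow> F \<noteq> {}"
  and face_frontier: "F \<in> Faces \<Longrightarrow> frontier F \<subseteq> D"
  unfolding faces_def
  using open_components[of "- D" F] compact_imp_closed[OF compact_D]
    frontier_of_components_closed_complement[of D F]
  by (auto simp: in_components_connected dest: in_components_nonempty in_components_subset)

lemma face_eq: "F \<in> Faces \<Longrightarrow> G \<in> Faces \<Longrightarrow> F \<inter> G \<noteq> {} \<Longrightarrow> F = G"
  unfolding faces_def using components_nonoverlap by blast

lemma face_maximal: "F \<in> Faces \<Longrightarrow> connected T \<Longrightarrow> T \<inter> D = {} \<Longrightarrow> F \<inter> T \<noteq> {} \<Longrightarrow> T \<subseteq> F"
  unfolding faces_def using components_maximal by (metis disjoint_eq_subset_Compl)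

lemma point_in_face: "z \<notin> D \<Longrightarrow> \<exists>F\<in>Faces. z \<in> F"
  unfolding faces_def using Union_components[of "- D"] by blast

lemma vertex_isolation:
  assumes "v \<in> V"
  obtains r where "0 < r" "\<And>u. u \<in> V \<Longrightarrow> u \<noteq> v \<Longrightarrow> r \<le> dist (p v) (p u)"
    "\<And>e z. e \<in> E \<Longrightarrow> v \<notin> e \<Longrightarrow> z \<in> path_image (\<gamma> e) \<Longrightarrow> r \<le> dist (p v) z"
proof -
  define K where "K = p ` (V - {v}) \<union> (\<Union>e\<in>{e\<in>E. v \<notin> e}. path_image (\<gamma> e))"
  have "closed K"
    unfolding K_def using finite_V finite_E edge_arc
    by (intro closed_Un closed_UN finite_imp_closed) (auto simp: closed_arc_image)
  moreover have "p v \<notin> K"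
    unfolding K_def using vertex_on_edge assms inj_p by (auto simp: inj_on_def)
  ultimately obtain r where "0 < r" "\<And>z. z \<in> K \<Longrightarrow> r \<le> dist (p v) z"
    using separate_point_closed by metis
  then show thesis using that[of r] unfolding K_def by blast
qed

text \<open>No vertex need be accessible from the face by an arc. Instead all arcs at the two vertices are
  redrawn: inside a small disc around the vertex an arc becomes the radius to its last point in
  that disc. The new arc can then be drawn along a further radius.\<close>

lemma planar_insert_face_chord:
  assumes vw: "v \<in> V" "w \<in> V" "v \<noteq> w" and new: "{v, w} \<notin> E"
    and F: "F \<in> Faces" "p v \<in> frontier F" "p w \<in> frontier F"
  shows "planar V (insert {v, w} E)"
proof -
  obtain rv where rv: "0 < rv" "\<And>u. u \<in> V \<Longrightarrow> u \<noteq> v \<Longrightarrow> rv \<le> dist (p v) (p u)"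
    "\<And>e z. e \<in> E \<Longrightarrow> v \<notin> e \<Longrightarrow> z \<in> path_image (\<gamma> e) \<Longrightarrow> rv \<le> dist (p v) z"
    using vertex_isolation[OF vw(1)] by metis
  obtain rw where rw: "0 < rw" "\<And>u. u \<in> V \<Longrightarrow> u \<noteq> w \<Longrightarrow> rw \<le> dist (p w) (p u)"
    "\<And>e z. e \<in> E \<Longrightarrow> w \<notin> e \<Longrightarrow> z \<in> path_image (\<gamma> e) \<Longrightarrow> rw \<le> dist (p w) z"
    using vertex_isolation[OF vw(2)] by metis
  \<comment> \<open>A third keeps the two closed discs of radius \<open>r\<close> disjoint and away
    from all other vertices and from the edges that do not end at their centre.\<close>
  define r where "r = min rv rw / 3"
  have r: "0 < r" "3 * r \<le> rv" "3 * r \<le> rw" using rv(1) rw(1) by (auto simp: r_def)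
  define B where "B c = cball (p c) r" for c
  have B_vertex: "p u \<notin> B c" if "u \<in> V" "c \<in> {v, w}" "u \<noteq> c" for u c
    using that rv(2)[of u] rw(2)[of u] r by (auto simp: B_def)
  have B_edge: "path_image (\<gamma> e) \<inter> B c = {}" if "e \<in> E" "c \<in> {v, w}" "c \<notin> e" for e c
    using that rv(3)[of e] rw(3)[of e] r by (force simp: B_def)
  have B_disj: "B v \<inter> B w = {}"
  proof (rule ccontr)
    assume "B v \<inter> B w \<noteq> {}"
    then obtain z where z: "dist (p v) z \<le> r" "dist (p w) z \<le> r" by (auto simp: B_def)
    have "rv \<le> dist (p v) (p w)" using rv(2) vw by auto
    also have "\<dots> \<le> dist (p v) z + dist (p w) z" by (rule dist_triangle2)
    finally show False using z r by linarith
  qed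
  have near: "\<exists>a. a \<in> F \<inter> ball (p c) r" if "c \<in> {v, w}" for c
  proof -
    have "p c \<in> closure F" using that F by (auto simp: frontier_def)
    then show ?thesis using r(1) by (metis IntI closure_approachable dist_commute mem_ball)
  qed
  obtain a b where a: "a \<in> F" "a \<in> ball (p v) r" and b: "b \<in> F" "b \<in> ball (p w) r"
    using near[of v] near[of w] by auto
  have aB: "a \<in> B v" "b \<in> B w" using a b by (auto simp: B_def)
  then have "a \<noteq> b" using B_disj by auto
  moreover have "path_connected F"
    using F by (simp add: connected_open_path_connected face_connected face_open)
  ultimately obtain \<pi> where \<pi>: "arc \<pi>" "path_image \<pi> \<subseteq> F" "pathstart \<pi> = a" "pathfinish \<pi> = b"
    using a b unfolding path_connected_arcwise by blast
  define E' where "E' = insert {v, w} E"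
  \<comment> \<open>The arc \<open>\<pi>\<close> stands for the new edge although it ends at
    \<open>a\<close> and \<open>b\<close> instead of the vertices: it satisfies the same
    disjointness conditions as the edges, and its ends are in the discs, where everything is
    redrawn.\<close>
  define G where "G e = (if e = {v, w} then path_image \<pi> else path_image (\<gamma> e))" for e
  have G_old: "G e = path_image (\<gamma> e)" if "e \<in> E" for e using that new by (auto simp: G_def)
  have \<pi>D: "path_image \<pi> \<inter> D = {}" using \<pi> face_disjoint[OF F(1)] by auto
  have G_vertex: "u \<in> e" if "e \<in> E'" "u \<in> V" "p u \<in> G e" for e u
  proof (cases "e = {v, w}")
    case True
    then show ?thesis using that \<pi>D vertex_in_D[of u] by (auto simp: G_def)
  next
    case False
    then show ?thesis using that vertex_on_edge G_old by (auto simp: E'_def)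
  qed
  have G_meet: "G e \<inter> G f \<subseteq> p ` (e \<inter> f)" if "e \<in> E'" "f \<in> E'" "e \<noteq> f" for e f
  proof (cases "e = {v, w} \<or> f = {v, w}")
    case True
    then have "G e \<inter> G f = {}"
      using that \<pi>D edge_subset_D unfolding G_def E'_def by auto
    then show ?thesis by simp
  next
    case False
    then show ?thesis using that edge_meet G_old by (auto simp: E'_def)
  qed
  \<comment> \<open>The arc \<open>h\<close> redraws \<open>e\<close>, and \<open>q c\<close> is the
    point on the circle around \<open>c\<close> where the radius takes over from the old
    arc.\<close>
  define R where "R e h q \<longleftrightarrow> arc h \<and> {pathstart h, pathfinish h} = p ` e \<and>
      (\<forall>c\<in>e \<inter> {v, w}. q c \<in> sphere (p c) r \<inter> G e) \<and>
      path_image h \<subseteq> (\<Union>c\<in>e \<inter> {v, w}. closed_segment (p c) (q c)) \<union> (G e - B v - B w)" for e h q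
  have "\<exists>h q. R e h q" if "e \<in> E'" for e
  proof (cases "e = {v, w}")
    case True
    \<comment> \<open>Both ends of \<open>\<pi>\<close> are redirected, at \<open>v\<close> and,
      after reversal, at \<open>w\<close>. As the discs are disjoint, the second change does not
      touch the first radius, and \<open>q2\<close> lies on \<open>\<pi>\<close>.\<close>
    have "b \<notin> cball (p v) r" using aB B_disj by (auto simp: B_def)
    then obtain h1 q1 where h1: "arc h1" "pathstart h1 = p v" "pathfinish h1 = b"
        "q1 \<in> sphere (p v) r" "q1 \<in> path_image \<pi>"
        "path_image h1 \<subseteq> closed_segment (p v) q1 \<union> (path_image \<pi> - B v)"
      using redirect_arc_to_centre[of \<pi> "p v" r] \<pi> a unfolding B_def by metis
    have "p v \<notin> cball (p w) r" using B_vertex[of v w] vw by (auto simp: B_def)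
    then obtain h2 q2 where h2: "arc h2" "pathstart h2 = p w" "pathfinish h2 = p v"
        "q2 \<in> sphere (p w) r" "q2 \<in> path_image h1"
        "path_image h2 \<subseteq> closed_segment (p w) q2 \<union> (path_image h1 - B w)"
      using redirect_arc_to_centre[of "reversepath h1" "p w" r] h1 b unfolding B_def
      by (metis arc_reversepath path_image_reversepath pathfinish_reversepath pathstart_reversepath)
    have "closed_segment (p v) q1 \<subseteq> B v"
      using h1(4) r(1) by (intro closed_segment_subset) (auto simp: B_def)
    moreover have "q2 \<in> B w" using h2(4) by (auto simp: B_def)
    ultimately have q2: "q2 \<in> path_image \<pi>" using h1(6) h2(5) B_disj by blast
    have "path_image h2 \<subseteq> closed_segment (p v) q1 \<union> closed_segment (p w) q2 \<union> (path_image \<pi> - B v - B w)"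
      using h1(6) h2(6) by blast
    moreover define q where "q = (\<lambda>c. if c = v then q1 else q2)"
    moreover have "e \<inter> {v, w} = {v, w}" "q v = q1" "q w = q2" "G e = path_image \<pi>"
      using True vw(3) by (simp_all add: q_def G_def)
    moreover have "{pathstart h2, pathfinish h2} = p ` e"
      using True h2(2,3) by (simp add: insert_commute)
    ultimately have "arc h2 \<and> {pathstart h2, pathfinish h2} = p ` e \<and>
      (\<forall>c\<in>e \<inter> {v, w}. q c \<in> sphere (p c) r \<inter> G e) \<and>
      path_image h2 \<subseteq> (\<Union>c\<in>e \<inter> {v, w}. closed_segment (p c) (q c)) \<union> (G e - B v - B w)"
      using h2(1,4) h1(4,5) q2 by simp
    then show ?thesis unfolding R_def by blast
  next
    case False
    then have e: "e \<in> E" using that by (auto simp: E'_def)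
    show ?thesis
    proof (cases "e \<inter> {v, w} = {}")
      case True
      have "path_image (\<gamma> e) \<inter> B v = {}" "path_image (\<gamma> e) \<inter> B w = {}"
        using B_edge[OF e] True by auto
      \<comment> \<open>The edge has no end at \<open>v\<close> or \<open>w\<close>, so it stays as
        it is and the choice of \<open>q\<close> is arbitrary.\<close>
      then show ?thesis
        unfolding R_def using edge_arc[OF e] edge_ends[OF e] G_old[OF e] True
        by (intro exI[of _ "\<gamma> e"] exI[of _ undefined]) auto
    next
      case c: False
      then obtain c where c: "c \<in> e" "c \<in> {v, w}" by blast
      obtain c' where c': "e = {c, c'}" "c' \<noteq> c" "c' \<in> V" using other_end[OF e c(1)] by metis
      \<comment> \<open>An old edge with both ends in \<open>{v, w}\<close> would be
        \<open>{v, w}\<close> itself, so only one disc is involved.\<close>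
      have only: "e \<inter> {v, w} = {c}" using c c' False by auto
      obtain g where g: "arc g" "pathstart g = p c" "pathfinish g = p c'" "path_image g = path_image (\<gamma> e)"
        using oriented_arc[of c c'] e c' by metis
      have "pathfinish g \<notin> cball (p c) r" using B_vertex[of c' c] c c' g by (auto simp: B_def)
          then obtain h q where h: "arc h" "pathstart h = p c" "pathfinish h = p c'"
        "q \<in> sphere (p c) r" "q \<in> path_image (\<gamma> e)"
        "path_image h \<subseteq> closed_segment (p c) q \<union> (path_image (\<gamma> e) - B c)"
        using redirect_arc_to_centre[of g "p c" r] g r(1) unfolding B_def by (metis centre_in_ball)
      have "path_image (\<gamma> e) \<inter> B d = {}" if "d \<in> {v, w}" "d \<noteq> c" for d
        using B_edge[OF e that(1)] only that by blast
      then have "path_image (\<gamma> e) \<inter> B v = {} \<or> v = c" "path_image (\<gamma> e) \<inter> B w = {} \<or> w = c"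
        by auto
      then have "path_image (\<gamma> e) - B c \<subseteq> path_image (\<gamma> e) - B v - B w"
        by blast
      then have "path_image h \<subseteq> closed_segment (p c) q \<union> (path_image (\<gamma> e) - B v - B w)"
        using h(6) by blast
      moreover have "{pathstart h, pathfinish h} = p ` e" using h c' by auto
      ultimately show ?thesis
        unfolding R_def only using h(1,4,5) G_old[OF e]
        by (intro exI[of _ h] exI[of _ "\<lambda>_. q"]) auto
    qed
  qed
  then obtain h q where "\<And>e. e \<in> E' \<Longrightarrow> R e (h e) (q e)"
    by metis
  then have h: "\<And>e. e \<in> E' \<Longrightarrow> arc (h e)"
      "\<And>e. e \<in> E' \<Longrightarrow> {pathstart (h e), pathfinish (h e)} = p ` e"
      and q: "\<And>e c. e \<in> E' \<Longrightarrow> c \<in> e \<inter> {v, w} \<Longrightarrow> q e c \<in> sphere (p c) r"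
      "\<And>e c. e \<in> E' \<Longrightarrow> c \<in> e \<inter> {v, w} \<Longrightarrow> q e c \<in> G e"
      and hq: "\<And>e. e \<in> E' \<Longrightarrow> path_image (h e) \<subseteq>
          (\<Union>c\<in>e \<inter> {v, w}. closed_segment (p c) (q e c)) \<union> (G e - B v - B w)"
    unfolding R_def by blast+
  have segB: "closed_segment (p c) (q e c) \<subseteq> B c" if "e \<in> E'" "c \<in> e \<inter> {v, w}" for e c
    using q(1)[OF that] r(1) unfolding B_def by (intro closed_segment_subset) auto
  have same_ball: "c = d" if "z \<in> B c" "z \<in> B d" "c \<in> {v, w}" "d \<in> {v, w}" for c d z
    using that B_disj by auto
  \<comment> \<open>A common point on the circle would be a common vertex of both edges, but the
    circle carries no vertex. So the radii of different arcs end in different points and meet only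
    in the centre.\<close>
  have q_neq: "q e c \<noteq> q f c" if asm: "e \<in> E'" "f \<in> E'" "e \<noteq> f" "c \<in> e \<inter> {v, w}" "c \<in> f \<inter> {v, w}" for e f c
  proof
    assume eq: "q e c = q f c"
    have "q e c \<in> G e" "q f c \<in> G f" using q(2) asm(1,2,4,5) by blast+
    then have "q e c \<in> G e \<inter> G f" using eq by simp
    then obtain u where u: "u \<in> e \<inter> f" "q e c = p u" using G_meet[OF asm(1-3)] by blast
    have "u \<in> V" using u asm vw edge_subset by (auto simp: E'_def)
    moreover have "p u \<in> sphere (p c) r" using u q(1) asm by metis
    ultimately show False using B_vertex[of u c] asm r(1) by (cases "u = c") (auto simp: B_def)
  qed
  have "plane_embedding V E' (\<lambda>e. e) p h"
    unfolding plane_embedding_def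
  proof (intro conjI ballI impI)
    show "inj_on p V" by (rule inj_p)
    fix e assume e: "e \<in> E'"
    show eV: "e \<subseteq> V" using e vw edge_subset by (auto simp: E'_def)
    show "arc (h e)" "{pathstart (h e), pathfinish (h e)} = p ` e" using h e by auto
    show "path_image (h e) \<inter> p ` V = p ` e"
    proof
      show "p ` e \<subseteq> path_image (h e) \<inter> p ` V"
        using h(2)[OF e] eV by (metis Int_subset_iff empty_subsetI image_mono insert_subset
            pathfinish_in_path_image pathstart_in_path_image)
      show "path_image (h e) \<inter> p ` V \<subseteq> p ` e"
      proof
        fix z assume "z \<in> path_image (h e) \<inter> p ` V"
        then obtain u where u: "u \<in> V" "z = p u" "p u \<in> path_image (h e)" by blast
        from u(3) hq[OF e] consider c where "c \<in> e \<inter> {v, w}" "p u \<in> closed_segment (p c) (q e c)" | "p u \<in> G e"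
          by blast
        then have "u \<in> e"
        proof cases
          case (1 c)
          then show ?thesis using segB[OF e 1(1)] B_vertex[OF u(1), of c] by auto
        next
          case 2
          then show ?thesis using G_vertex[OF e u(1)] by simp
        qed
        then show "z \<in> p ` e" using u by simp
      qed
    qed
    fix f assume f: "f \<in> E'" and ef: "e \<noteq> f"
    show "path_image (h e) \<inter> path_image (h f) \<subseteq> p ` (e \<inter> f)"
    proof
      fix z assume "z \<in> path_image (h e) \<inter> path_image (h f)"
      then have ze: "z \<in> (\<Union>c\<in>e \<inter> {v, w}. closed_segment (p c) (q e c)) \<union> (G e - B v - B w)"
        and zf: "z \<in> (\<Union>c\<in>f \<inter> {v, w}. closed_segment (p c) (q f c)) \<union> (G f - B v - B w)"
        using hq[OF e] hq[OF f] by blast+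
      show "z \<in> p ` (e \<inter> f)"
      proof (cases "z \<in> B v \<union> B w")
        case True
        then obtain c d where c: "c \<in> e \<inter> {v, w}" "z \<in> closed_segment (p c) (q e c)"
          and d: "d \<in> f \<inter> {v, w}" "z \<in> closed_segment (p d) (q f d)"
          using ze zf by blast
        have "c = d"
          using same_ball[of z c d] segB[OF e c(1)] segB[OF f d(1)] c d by blast
        then have "z = p c"
          using radii_meet_in_centre[of "q e c" "p c" r "q f c" z] q_neq[OF e f ef, of c] q(1)[OF e, of c] q(1)[OF f, of c] c d
          by auto
        then show ?thesis using \<open>c = d\<close> c d by blast
      next
        case False
        then have "z \<in> G e" "z \<in> G f"
          using ze zf segB[OF e] segB[OF f] by blast+
        then show ?thesis using G_meet[OF e f ef] by blast
      qed
    qed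
  qed
  then show ?thesis unfolding planar_def E'_def by blast
qed

subsection \<open>Faces and edges\<close>

lemma edge_interior:
  assumes "e \<in> E"
  shows "path_image (\<gamma> e) - p ` e = \<gamma> e ` {0<..<1}" "connected (path_image (\<gamma> e) - p ` e)"
    "path_image (\<gamma> e) \<subseteq> closure (path_image (\<gamma> e) - p ` e)"
proof -
  have ends: "p ` e = {pathstart (\<gamma> e), pathfinish (\<gamma> e)}" using edge_ends[OF assms] by simp
  show eq: "path_image (\<gamma> e) - p ` e = \<gamma> e ` {0<..<1}"
    unfolding ends using simple_path_endless[of "\<gamma> e"] edge_arc[OF assms] by (simp add: arc_imp_simple_path)
  show "connected (path_image (\<gamma> e) - p ` e)"
    unfolding ends using edge_arc[OF assms] by (intro connected_simple_path_endless arc_imp_simple_path)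
  have "continuous_on (closure {0<..<1}) (\<gamma> e)"
    using edge_arc[OF assms] by (simp add: arc_def path_def)
  then have "\<gamma> e ` closure {0<..<1} \<subseteq> closure (\<gamma> e ` {0<..<1})"
    by (rule image_closure_subset) (auto simp: closure_subset)
  then show "path_image (\<gamma> e) \<subseteq> closure (path_image (\<gamma> e) - p ` e)"
    unfolding eq by (simp add: path_image_def)
qed

lemma midpoint_interior: "e \<in> E \<Longrightarrow> edge_midpoint \<gamma> e \<in> path_image (\<gamma> e) - p ` e"
  unfolding edge_interior by (simp add: edge_midpoint_def)

lemma interior_not_vertex: "e \<in> E \<Longrightarrow> x \<in> path_image (\<gamma> e) - p ` e \<Longrightarrow> x \<notin> p ` V"
  using edge_verts by blast

lemma interior_not_on_other_edge:
  "e \<in> E \<Longrightarrow> f \<in> E \<Longrightarrow> x \<in> path_image (\<gamma> e) - p ` e \<Longrightarrow> x \<in> path_image (\<gamma> f) \<Longrightarrow> e = f"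
  using edge_meet by blast

lemma frontier_face: "F \<in> Faces \<Longrightarrow> x \<in> frontier F \<longleftrightarrow> x \<in> closure F \<and> x \<notin> F"
  using face_open by (simp add: frontier_def interior_open)

text \<open>The vertices and the other edges form a closed set, so near an interior point of an edge
  the drawing consists of that edge alone. Each local side of the arc then lies in one face. The
  case \<open>F1 = F2\<close> is not excluded here.\<close>

lemma edge_locally_two_faces:
  assumes e: "e \<in> E" and x: "x \<in> path_image (\<gamma> e) - p ` e"
  obtains \<delta> F1 F2 where "0 < \<delta>" "F1 \<in> Faces" "F2 \<in> Faces" "ball x \<delta> \<subseteq> path_image (\<gamma> e) \<union> F1 \<union> F2"
    "path_image (\<gamma> e) \<inter> ball x \<delta> \<subseteq> frontier F1 \<inter> frontier F2"
proof -
  define K where "K = p ` V \<union> (\<Union>f\<in>E - {e}. path_image (\<gamma> f))"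
  have "closed K"
    unfolding K_def using finite_V finite_E edge_arc
    by (intro closed_Un closed_UN finite_imp_closed) (auto simp: closed_arc_image)
  moreover have "x \<notin> K"
    unfolding K_def using interior_not_vertex[OF e x] interior_not_on_other_edge[OF e _ x] by blast
  ultimately obtain \<epsilon> where \<epsilon>: "0 < \<epsilon>" "\<And>z. z \<in> K \<Longrightarrow> \<epsilon> \<le> dist x z"
    using separate_point_closed by metis
  have "ball x \<epsilon> \<inter> K = {}" using \<epsilon>(2) by (meson disjoint_iff mem_ball not_less)
  then have D\<epsilon>: "ball x \<epsilon> \<inter> D \<subseteq> path_image (\<gamma> e)"
    unfolding drawing_def K_def by blast
  obtain t where t: "x = \<gamma> e t" "0 < t" "t < 1" using x unfolding edge_interior[OF e] by auto
  obtain \<delta> A B where AB: "0 < \<delta>" "connected A" "connected B"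
    "A \<subseteq> ball x \<epsilon> - path_image (\<gamma> e)" "B \<subseteq> ball x \<epsilon> - path_image (\<gamma> e)"
    "ball x \<delta> - path_image (\<gamma> e) \<subseteq> A \<union> B"
    "path_image (\<gamma> e) \<inter> ball x \<delta> \<subseteq> closure A \<inter> closure B"
    using arc_locally_two_sided[OF edge_arc[OF e] t(2,3) \<epsilon>(1)] unfolding t(1) by metis
  have face: "\<exists>F\<in>Faces. A \<subseteq> F \<and> path_image (\<gamma> e) \<inter> ball x \<delta> \<subseteq> frontier F"
    if A: "connected A" "A \<subseteq> ball x \<epsilon> - path_image (\<gamma> e)" "path_image (\<gamma> e) \<inter> ball x \<delta> \<subseteq> closure A" for A
  proof -
    have "x \<in> closure A" using A(3) x AB(1) by auto
    then obtain y where y: "y \<in> A" by (metis closure_empty empty_iff ex_in_conv)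
    have "A \<inter> D = {}" using A(2) D\<epsilon> by blast
    then obtain F where F: "F \<in> Faces" "y \<in> F" using point_in_face y by blast
    have "A \<subseteq> F" using face_maximal[OF F(1) A(1) \<open>A \<inter> D = {}\<close>] y F by blast
    moreover have "path_image (\<gamma> e) \<inter> ball x \<delta> \<subseteq> frontier F"
      using A(3) closure_mono[OF \<open>A \<subseteq> F\<close>] face_disjoint[OF F(1)] edge_subset_D[OF e] frontier_face[OF F(1)]
      by blast
    ultimately show ?thesis using F by blast
  qed
  obtain F1 where F1: "F1 \<in> Faces" "A \<subseteq> F1" "path_image (\<gamma> e) \<inter> ball x \<delta> \<subseteq> frontier F1"
    using face[of A] AB by blast
  obtain F2 where F2: "F2 \<in> Faces" "B \<subseteq> F2" "path_image (\<gamma> e) \<inter> ball x \<delta> \<subseteq> frontier F2"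
    using face[of B] AB by blast
  show thesis
    using that[OF AB(1) F1(1) F2(1)] AB(6) F1 F2 by blast
qed

text \<open>The part of the open edge on \<open>frontier F\<close> is closed in it, and also open,
  because locally only two faces occur and both have the whole piece of edge on their frontier. The
  open edge is connected.\<close>

lemma edge_in_frontier:
  assumes e: "e \<in> E" and F: "F \<in> Faces" and x: "x \<in> path_image (\<gamma> e) - p ` e" "x \<in> frontier F"
  shows "e \<in> boundary_edges E \<gamma> F"
proof -
  let ?M = "path_image (\<gamma> e) - p ` e"
  have "openin (top_of_set ?M) (?M \<inter> frontier F)"
    unfolding openin_contains_ball
  proof (intro conjI ballI)
    fix y assume y: "y \<in> ?M \<inter> frontier F"
    obtain \<delta> F1 F2 where *: "0 < \<delta>" "F1 \<in> Faces" "F2 \<in> Faces" "ball y \<delta> \<subseteq> path_image (\<gamma> e) \<union> F1 \<union> F2"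
      "path_image (\<gamma> e) \<inter> ball y \<delta> \<subseteq> frontier F1 \<inter> frontier F2"
      using edge_locally_two_faces[OF e, of y] y by blast
    have "y \<in> closure F" using y by (simp add: frontier_def)
    then obtain z where "z \<in> F" "z \<in> ball y \<delta>" using *(1) by (metis closure_approachable dist_commute mem_ball)
    then have "F = F1 \<or> F = F2"
      using *(4) face_disjoint[OF F] edge_subset_D[OF e] face_eq[OF F *(2)] face_eq[OF F *(3)] by blast
    then show "\<exists>\<delta>>0. ball y \<delta> \<inter> ?M \<subseteq> ?M \<inter> frontier F" using * by blast
  qed blast
  moreover have "closedin (top_of_set ?M) (?M \<inter> frontier F)"
    by (simp add: closedin_closed_Int)
  ultimately have "?M \<inter> frontier F = ?M"
    using edge_interior(2)[OF e] x unfolding connected_clopen by blast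
  then have "closure ?M \<subseteq> frontier F" by (intro closure_minimal) auto
  then show ?thesis using edge_interior(3)[OF e] e by (auto simp: boundary_edges_def)
qed

text \<open>Every face with \<open>e\<close> on its boundary comes close to the midpoint, where only
  two faces are present; hence the pair found there serves all along the edge. The two may still
  coincide until \<open>card_sides\<close>.\<close>

lemma edge_two_sides:
  assumes e: "e \<in> E"
  obtains F1 F2 where "{F \<in> Faces. e \<in> boundary_edges E \<gamma> F} = {F1, F2}"
    "\<forall>x\<in>path_image (\<gamma> e) - p ` e. \<exists>\<delta>>0. ball x \<delta> \<subseteq> path_image (\<gamma> e) \<union> F1 \<union> F2"
proof -
  let ?S = "{F \<in> Faces. e \<in> boundary_edges E \<gamma> F}"
  have loc: "\<exists>\<delta>>0. \<exists>F1\<in>?S. \<exists>F2\<in>?S. ball x \<delta> \<subseteq> path_image (\<gamma> e) \<union> F1 \<union> F2"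
    if x: "x \<in> path_image (\<gamma> e) - p ` e" for x
  proof -
    obtain \<delta> F1 F2 where *: "0 < \<delta>" "F1 \<in> Faces" "F2 \<in> Faces" "ball x \<delta> \<subseteq> path_image (\<gamma> e) \<union> F1 \<union> F2"
      "path_image (\<gamma> e) \<inter> ball x \<delta> \<subseteq> frontier F1 \<inter> frontier F2"
      using edge_locally_two_faces[OF e x] by metis
    then have "x \<in> frontier F1" "x \<in> frontier F2" using x by auto
    then have "F1 \<in> ?S" "F2 \<in> ?S" using edge_in_frontier[OF e _ x] * by auto
    then show ?thesis using * by blast
  qed
  obtain \<delta> F1 F2 where m: "0 < \<delta>" "F1 \<in> ?S" "F2 \<in> ?S"
      "ball (edge_midpoint \<gamma> e) \<delta> \<subseteq> path_image (\<gamma> e) \<union> F1 \<union> F2"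
    using loc[OF midpoint_interior[OF e]] by blast
  have S: "?S = {F1, F2}"
  proof
    show "{F1, F2} \<subseteq> ?S" using m by blast
    show "?S \<subseteq> {F1, F2}"
    proof
      fix F assume F: "F \<in> ?S"
      then have "edge_midpoint \<gamma> e \<in> closure F"
        using midpoint_interior[OF e] by (auto simp: boundary_edges_def frontier_def)
      then obtain z where "z \<in> F" "z \<in> ball (edge_midpoint \<gamma> e) \<delta>"
        using m(1) by (metis closure_approachable dist_commute mem_ball)
      then show "F \<in> {F1, F2}"
        using F m(2-4) face_disjoint[of F] edge_subset_D[OF e] face_eq[of F F1] face_eq[of F F2] by blast
    qed
  qed
  show thesis
  proof (rule that[OF S], rule ballI)
    fix x assume "x \<in> path_image (\<gamma> e) - p ` e"
    then obtain \<delta>' G1 G2 where "0 < \<delta>'" "G1 \<in> ?S" "G2 \<in> ?S" "ball x \<delta>' \<subseteq> path_image (\<gamma> e) \<union> G1 \<union> G2"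
      using loc by blast
    then show "\<exists>\<delta>>0. ball x \<delta> \<subseteq> path_image (\<gamma> e) \<union> F1 \<union> F2"
      unfolding S by blast
  qed
qed

text \<open>The vertices are listed separately because an isolated vertex on the frontier lies on no
  boundary edge.\<close>

lemma frontier_face_subset:
  assumes F: "F \<in> Faces"
  shows "frontier F \<subseteq> (\<Union>e\<in>boundary_edges E \<gamma> F. path_image (\<gamma> e)) \<union> p ` {v \<in> V. p v \<in> frontier F}"
proof
  fix x assume x: "x \<in> frontier F"
  then have "x \<in> D" using face_frontier[OF F] by blast
  then consider v where "v \<in> V" "x = p v" | e where "e \<in> E" "x \<in> path_image (\<gamma> e) - p ` e"
    unfolding drawing_def using edge_subset by blast
  then show "x \<in> (\<Union>e\<in>boundary_edges E \<gamma> F. path_image (\<gamma> e)) \<union> p ` {v \<in> V. p v \<in> frontier F}"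
  proof cases
    case 1
    then show ?thesis using x by blast
  next
    case 2
    then show ?thesis using edge_in_frontier[OF 2(1) F 2(2) x] by blast
  qed
qed

lemma boundary_edge_vertex:
  assumes "e \<in> boundary_edges E \<gamma> F" "v \<in> e" shows "v \<in> V" "p v \<in> frontier F"
  using assms edge_subset[of e] vertex_on_edge[of e v] by (auto simp: boundary_edges_def)

section \<open>Pairs of edges, and diagonals of four-cycles\<close>

text \<open>Two different edges of a simple graph share at most one vertex, so their arcs meet in a
  connected set and Janiszewski's theorem applies to their union.\<close>

lemma connected_complement_two_edges:
  assumes "B \<subseteq> E" "card B \<le> 2"
  shows "connected (- (\<Union>e\<in>B. path_image (\<gamma> e)))"
proof -
  have "finite B" using assms finite_E finite_subset by auto
  have arc_compl: "connected (- path_image (\<gamma> e))" if "e \<in> E" for e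
    using edge_arc[OF that] by (simp add: connected_arc_complement)
  consider "B = {}" | e where "B = {e}" | e f where "B = {e, f}" "e \<noteq> f"
    using assms(2) \<open>finite B\<close> by (metis One_nat_def card_0_eq card_1_singletonE card_2_iff le_Suc_eq le_zero_eq numeral_2_eq_2)
  then show ?thesis
  proof cases
    case 3
    have "card (e \<inter> f) < 2"
    proof -
      have "finite e" "finite f" "card e = 2" "card f = 2"
        using 3 assms edge_card[of e] edge_card[of f] edge_subset[of e] edge_subset[of f] finite_V
        by (simp_all add: finite_subset)
      then show ?thesis using 3(2) by (metis Int_lower1 Int_lower2 card_mono card_subset_eq linorder_not_less order_antisym)
    qed
    moreover have "finite (e \<inter> f)" using 3 assms edge_subset[of e] finite_V
      by (simp add: finite_subset)
    ultimately obtain v where "e \<inter> f \<subseteq> {v}"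
      by (metis One_nat_def card_0_eq card_1_singletonE empty_subsetI less_2_cases order.refl)
    then have "path_image (\<gamma> e) \<inter> path_image (\<gamma> f) \<subseteq> {p v}"
      using edge_meet[of e f] 3 assms by blast
    then have "connected (path_image (\<gamma> e) \<inter> path_image (\<gamma> f))"
      by (metis connected_empty connected_sing subset_singletonD)
    then have "connected (- (path_image (\<gamma> e) \<union> path_image (\<gamma> f)))"
      using 3 assms edge_arc arc_compl
      by (intro Janiszewski_connected) (auto simp: compact_arc_image closed_arc_image)
    then show ?thesis using 3 by simp
  qed (use arc_compl assms in auto)
qed

text \<open>The chord from \<open>a\<close> to \<open>c\<close> splits its side of the cycle into
  two parts, one away from \<open>b\<close> and one away from \<open>d\<close>. \<open>W\<close> is
  general because it stands for a face in some uses and for the other open diagonal in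
  another.\<close>

lemma no_common_side_of_four_cycle:
  assumes edges: "{a, b} \<in> E" "{b, c} \<in> E" "{c, d} \<in> E" "{d, a} \<in> E" "{a, c} \<in> E"
    and dist: "distinct [a, b, c, d]"
    and J: "J = path_image (\<gamma> {a, b}) \<union> path_image (\<gamma> {b, c}) \<union> path_image (\<gamma> {c, d}) \<union> path_image (\<gamma> {d, a})"
    and W: "connected W" "W \<inter> J = {}" "W \<inter> path_image (\<gamma> {a, c}) = {}" "p b \<in> closure W" "p d \<in> closure W"
    and side: "W \<inter> inside J \<noteq> {} \<and> path_image (\<gamma> {a, c}) \<inter> inside J \<noteq> {} \<or>
      W \<inter> outside J \<noteq> {} \<and> path_image (\<gamma> {a, c}) \<inter> outside J \<noteq> {}"
  shows False
proof -
  have V: "a \<in> V" "b \<in> V" "c \<in> V" "d \<in> V" using edges edge_subset by auto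
  have pd: "p a \<noteq> p b" "p a \<noteq> p c" "p a \<noteq> p d" "p b \<noteq> p c" "p b \<noteq> p d" "p c \<noteq> p d"
    using inj_p V dist by (auto simp: inj_on_def)
  have meet: "path_image (\<gamma> {x, y}) \<inter> path_image (\<gamma> {x', y'}) \<subseteq> p ` ({x, y} \<inter> {x', y'})"
    if "{x, y} \<in> E" "{x', y'} \<in> E" "{x, y} \<noteq> {x', y'}" for x y x' y'
    using edge_meet[OF that] .
  have in_edge: "p x \<in> path_image (\<gamma> {x, y})" "p y \<in> path_image (\<gamma> {x, y})" if "{x, y} \<in> E" for x y
    using vertex_on_edge[OF that] edge_subset[OF that] by auto
  have not_in: "p z \<notin> path_image (\<gamma> {x, y})" if "{x, y} \<in> E" "z \<in> V" "z \<noteq> x" "z \<noteq> y" for x y z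
    using vertex_on_edge[OF that(1,2)] that by auto
  have two: "\<exists>h. arc h \<and> pathstart h = p x \<and> pathfinish h = p z \<and>
      path_image h = path_image (\<gamma> {x, y}) \<union> path_image (\<gamma> {y, z})"
    if e: "{x, y} \<in> E" "{y, z} \<in> E" and "x \<noteq> z" "y \<noteq> x" "y \<noteq> z" for x y z
  proof -
    obtain g where g: "arc g" "pathstart g = p x" "pathfinish g = p y" "path_image g = path_image (\<gamma> {x, y})"
      using oriented_arc[OF e(1)] by metis
    obtain h where h: "arc h" "pathstart h = p y" "pathfinish h = p z" "path_image h = path_image (\<gamma> {y, z})"
      using oriented_arc[OF e(2)] by metis
    have "{x, y} \<noteq> {y, z}" "{x, y} \<inter> {y, z} = {y}" using that by auto
    then have "path_image (\<gamma> {x, y}) \<inter> path_image (\<gamma> {y, z}) \<subseteq> {p y}"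
      using meet[OF e] by (metis image_empty image_insert)
    then have "path_image g \<inter> path_image h \<subseteq> {pathstart h}"
      using g h by simp
    then have "arc (g +++ h)" using g h by (intro arc_join) auto
    then show ?thesis using g h by (intro exI[of _ "g +++ h"]) (simp add: path_image_join)
  qed
  obtain c1 where c1: "arc c1" "pathstart c1 = p a" "pathfinish c1 = p c"
      "path_image c1 = path_image (\<gamma> {a, b}) \<union> path_image (\<gamma> {b, c})"
    using two[OF edges(1,2)] dist by auto
  have edges': "{a, d} \<in> E" "{d, c} \<in> E" using edges by (simp_all add: insert_commute)
  obtain c2 where c2: "arc c2" "pathstart c2 = p a" "pathfinish c2 = p c"
      "path_image c2 = path_image (\<gamma> {a, d}) \<union> path_image (\<gamma> {d, c})"
    using two[OF edges'] dist by auto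
  obtain k where k: "arc k" "pathstart k = p a" "pathfinish k = p c" "path_image k = path_image (\<gamma> {a, c})"
    using oriented_arc[OF edges(5)] by metis
  have i1: "path_image c1 \<inter> path_image c2 = {p a, p c}"
  proof -
    have "path_image (\<gamma> {a, b}) \<inter> path_image (\<gamma> {a, d}) \<subseteq> {p a}" "path_image (\<gamma> {a, b}) \<inter> path_image (\<gamma> {d, c}) \<subseteq> {}"
      "path_image (\<gamma> {b, c}) \<inter> path_image (\<gamma> {a, d}) \<subseteq> {}" "path_image (\<gamma> {b, c}) \<inter> path_image (\<gamma> {d, c}) \<subseteq> {p c}"
      using meet[OF edges(1) edges'(1)] meet[OF edges(1) edges'(2)] meet[OF edges(2) edges'(1)]
        meet[OF edges(2) edges'(2)] dist by (auto simp: doubleton_eq_iff)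
    then show ?thesis
      unfolding c1 c2 using in_edge[OF edges(1)] in_edge[OF edges(2)] in_edge[OF edges'(1)] in_edge[OF edges'(2)] by blast
  qed
  have i2: "path_image c1 \<inter> path_image k = {p a, p c}"
  proof -
    have "path_image (\<gamma> {a, b}) \<inter> path_image (\<gamma> {a, c}) \<subseteq> {p a}" "path_image (\<gamma> {b, c}) \<inter> path_image (\<gamma> {a, c}) \<subseteq> {p c}"
      using meet[OF edges(1) edges(5)] meet[OF edges(2) edges(5)] dist by (auto simp: doubleton_eq_iff)
    then show ?thesis
      unfolding c1 k using in_edge[OF edges(1)] in_edge[OF edges(2)] in_edge[OF edges(5)] by blast
  qed
  have i3: "path_image c2 \<inter> path_image k = {p a, p c}"
  proof -
    have "path_image (\<gamma> {a, d}) \<inter> path_image (\<gamma> {a, c}) \<subseteq> {p a}" "path_image (\<gamma> {d, c}) \<inter> path_image (\<gamma> {a, c}) \<subseteq> {p c}"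
      using meet[OF edges'(1) edges(5)] meet[OF edges'(2) edges(5)] dist by (auto simp: doubleton_eq_iff)
    then show ?thesis
      unfolding c2 k using in_edge[OF edges'(1)] in_edge[OF edges'(2)] in_edge[OF edges(5)] by blast
  qed
  have J': "path_image c1 \<union> path_image c2 = J"
    unfolding c1 c2 J by (auto simp: insert_commute)
  have b: "p b \<in> path_image c1 - {p a, p c}" and d: "p d \<in> path_image c2 - {p a, p c}"
    unfolding c1 c2 using in_edge[OF edges(1)] in_edge[OF edges'(1)] pd by auto
  have W': "W \<inter> (path_image c1 \<union> path_image c2 \<union> path_image k) = {}"
    using W(2,3) J' k(4) by blast
  show False
    using side chord_splits_inside[OF c1(1-3) c2(1-3) k(1-3) i1 i2 i3 _ W(1) W' _ b W(4) d W(5)]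
      chord_splits_outside[OF c1(1-3) c2(1-3) k(1-3) i1 i2 i3 _ W(1) W' _ b W(4) d W(5)]
    unfolding J' k(4) by blast
qed

lemma no_four_clique_on_face:
  assumes F: "F \<in> Faces" and dist: "distinct [a, b, c, d]"
    and edges: "{a, b} \<in> E" "{b, c} \<in> E" "{c, d} \<in> E" "{d, a} \<in> E" "{a, c} \<in> E" "{b, d} \<in> E"
    and fr: "p a \<in> frontier F" "p b \<in> frontier F" "p c \<in> frontier F" "p d \<in> frontier F"
  shows False
proof -
  define J where "J = path_image (\<gamma> {a, b}) \<union> path_image (\<gamma> {b, c}) \<union> path_image (\<gamma> {c, d}) \<union> path_image (\<gamma> {d, a})"
  have J': "J = path_image (\<gamma> {b, c}) \<union> path_image (\<gamma> {c, d}) \<union> path_image (\<gamma> {d, a}) \<union> path_image (\<gamma> {a, b})"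
    unfolding J_def by blast
  have dist': "distinct [b, c, d, a]" and edges': "{c, a} \<in> E" using dist edges by (auto simp: insert_commute)
  have cl: "p a \<in> closure F" "p b \<in> closure F" "p c \<in> closure F" "p d \<in> closure F"
    using fr by (auto simp: frontier_def)
  have sub: "J \<subseteq> D" "path_image (\<gamma> {a, c}) \<subseteq> D" "path_image (\<gamma> {b, d}) \<subseteq> D"
    unfolding J_def using edge_subset_D edges by blast+
  have FD: "F \<inter> J = {}" "F \<inter> path_image (\<gamma> {a, c}) = {}" "F \<inter> path_image (\<gamma> {b, d}) = {}"
    using sub face_disjoint[OF F] by blast+
  note side = no_common_side_of_four_cycle[OF edges(1-5) dist J_def]
  have edges'': "{b, d} \<in> E" by (fact edges(6))
  note side' = no_common_side_of_four_cycle[OF edges(2-4) edges(1) edges'' dist' J']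
  \<comment> \<open>\<open>A\<close>, \<open>B\<close> and \<open>C\<close> forbid a common side to
    the face and the diagonal \<open>{a, c}\<close>, to the face and \<open>{b, d}\<close>, and to
    the two diagonals. \<open>B\<close> uses the cycle rotated by one place.\<close>
  note A = side[OF face_connected[OF F] FD(1,2) cl(2,4)]
  note B = side'[OF face_connected[OF F] FD(1,3) cl(3,1)]
  let ?W = "path_image (\<gamma> {b, d}) - p ` {b, d}"
  have int: "x \<notin> J" if "e = {b, d} \<or> e = {a, c}" "x \<in> path_image (\<gamma> e) - p ` e" for e x
  proof -
    have "e \<in> E" using that(1) edges by auto
    then have "f \<noteq> e \<Longrightarrow> f \<in> E \<Longrightarrow> x \<notin> path_image (\<gamma> f)" for f
      using interior_not_on_other_edge[OF _ _ that(2)] by metis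
    then show ?thesis using that(1) edges dist unfolding J_def by (auto simp: doubleton_eq_iff)
  qed
  have W: "?W \<inter> J = {}" using int by blast
  have W2: "?W \<inter> path_image (\<gamma> {a, c}) = {}"
    using interior_not_on_other_edge[OF edges(6) edges(5)] dist by (auto simp: doubleton_eq_iff)
  have "p ` {b, d} \<subseteq> path_image (\<gamma> {b, d})"
    using edge_verts[OF edges(6)] by blast
  then have Wcl: "p b \<in> closure ?W" "p d \<in> closure ?W"
    using edge_interior(3)[OF edges(6)] by blast+
  note C = side[OF edge_interior(2)[OF edges(6)] W W2 Wcl]
  define x where "x = edge_midpoint \<gamma> {a, c}"
  define y where "y = edge_midpoint \<gamma> {b, d}"
  have x: "x \<in> path_image (\<gamma> {a, c})" "x \<in> inside J \<or> x \<in> outside J"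
    using midpoint_interior[OF edges(5)] int[of "{a, c}" x] inside_Un_outside[of J] unfolding x_def by blast+
  have y: "y \<in> ?W" "y \<in> inside J \<or> y \<in> outside J"
    using midpoint_interior[OF edges(6)] int[of "{b, d}" y] inside_Un_outside[of J] unfolding y_def by blast+
  obtain z where z: "z \<in> F" "z \<in> inside J \<or> z \<in> outside J"
    using face_nonempty[OF F] FD(1) inside_Un_outside[of J] by blast
  show False
    using A B C x y z by blast
qed

end

subsection \<open>Faces of maximal plane graphs\<close>

locale maximal_plane_graph = plane_graph +
  assumes maximal: "\<And>e. e \<subseteq> V \<Longrightarrow> card e = 2 \<Longrightarrow> e \<notin> E \<Longrightarrow> \<not> planar V (insert e E)"
    and card_V: "3 \<le> card V"
begin

abbreviation "bdry \<equiv> boundary_edges E \<gamma>"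
definition "sides e = {F \<in> Faces. e \<in> bdry F}"

lemma mem_sides: "F \<in> sides e \<longleftrightarrow> F \<in> Faces \<and> e \<in> bdry F"
  by (simp add: sides_def)

lemma frontier_vertices_adjacent:
  assumes "F \<in> Faces" "v \<in> V" "w \<in> V" "v \<noteq> w" "p v \<in> frontier F" "p w \<in> frontier F"
  shows "{v, w} \<in> E"
proof (rule ccontr)
  assume "{v, w} \<notin> E"
  then have "planar V (insert {v, w} E)"
    using planar_insert_face_chord assms by blast
  moreover have "card {v, w} = 2" using assms by simp
  ultimately show False using maximal[of "{v, w}"] assms \<open>{v, w} \<notin> E\<close> by blast
qed

text \<open>With at most two boundary edges, removing the frontier of a face would not disconnect the
  plane, so the face would be everything else.\<close>

lemma boundary_edges_ge_3:
  assumes F: "F \<in> Faces"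
  shows "3 \<le> card (bdry F)"
proof (rule ccontr)
  assume "\<not> 3 \<le> card (bdry F)"
  then have c2: "card (bdry F) \<le> 2" by simp
  define X where "X = (\<Union>e\<in>bdry F. path_image (\<gamma> e))"
  \<comment> \<open>The vertices are removed too because isolated ones may lie on
    \<open>frontier F\<close>; a finite set does not disconnect a connected open set of the
    plane.\<close>
  define N where "N = - X - p ` V"
  have bE: "bdry F \<subseteq> E" by (auto simp: boundary_edges_def)
  have "finite (bdry F)" using bE finite_E finite_subset by auto
  then have "closed X"
    unfolding X_def using bE edge_arc by (intro closed_UN) (auto simp: closed_arc_image)
  have "connected (- X)" unfolding X_def by (rule connected_complement_two_edges[OF bE c2])
  then have "connected N"
    unfolding N_def using \<open>closed X\<close> finite_V
    by (intro connected_open_diff_countable) (simp_all add: open_Compl countable_finite)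
  have XD: "X \<subseteq> D" using bE edge_subset_D unfolding X_def by blast
  have "F \<subseteq> N"
    using face_disjoint[OF F] XD vertex_in_D unfolding N_def by blast
  have frN: "N \<inter> frontier F = {}"
    using frontier_face_subset[OF F] unfolding N_def X_def by blast
  have "N \<subseteq> F"
  proof (rule ccontr)
    assume "\<not> N \<subseteq> F"
    then have "N \<inter> frontier F \<noteq> {}"
      using connected_Int_frontier[OF \<open>connected N\<close>, of F] \<open>F \<subseteq> N\<close> face_nonempty[OF F] by blast
    then show False using frN by simp
  qed
  \<comment> \<open>As \<open>F\<close> contains everything off \<open>X\<close> except vertices,
    the midpoint of an edge can only lie on \<open>X\<close>, so every edge bounds
    \<open>F\<close>.\<close>
  have "E \<subseteq> bdry F"
  proof
    fix e assume e: "e \<in> E"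
    have "edge_midpoint \<gamma> e \<notin> F"
      using midpoint_interior[OF e] edge_subset_D[OF e] face_disjoint[OF F] by blast
    then have "edge_midpoint \<gamma> e \<in> X"
      using \<open>N \<subseteq> F\<close> interior_not_vertex[OF e midpoint_interior[OF e]] unfolding N_def by blast
    then show "e \<in> bdry F"
      using interior_not_on_other_edge[OF e _ midpoint_interior[OF e]] bE unfolding X_def by blast
  qed
  then have Eb: "E = bdry F" using bE by blast
  \<comment> \<open>A vertex without edges has a punctured disc around it in \<open>N\<close>, hence
    in \<open>F\<close>.\<close>
  have all: "p v \<in> frontier F" if v: "v \<in> V" for v
  proof (cases "\<exists>e\<in>E. v \<in> e")
    case True
    then show ?thesis using Eb boundary_edge_vertex(2) by blast
  next
    case False
    obtain r where r: "0 < r" "\<And>u. u \<in> V \<Longrightarrow> u \<noteq> v \<Longrightarrow> r \<le> dist (p v) (p u)"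
      "\<And>e z. e \<in> E \<Longrightarrow> v \<notin> e \<Longrightarrow> z \<in> path_image (\<gamma> e) \<Longrightarrow> r \<le> dist (p v) z"
      using vertex_isolation[OF v] by metis
    have punctured: "z \<in> N" if "dist (p v) z < r" "z \<noteq> p v" for z
    proof -
      have "z \<notin> X" using r(3) False that(1) bE unfolding X_def by fastforce
      moreover have "z \<notin> p ` V" using r(2) that by fastforce
      ultimately show ?thesis by (simp add: N_def)
    qed
    have "ball (p v) r - {p v} \<subseteq> N"
    proof
      fix z assume "z \<in> ball (p v) r - {p v}"
      then show "z \<in> N" using punctured[of z] by simp
    qed
    then have "ball (p v) r - {p v} \<subseteq> F" using \<open>N \<subseteq> F\<close> by blast
    moreover have "p v \<in> closure (ball (p v) r - {p v})"
      using r(1) by (simp add: islimpt_in_closure[symmetric] islimpt_ball)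
    ultimately have "p v \<in> closure F" using closure_mono by blast
    then show ?thesis
      using frontier_face[OF F] face_disjoint[OF F] vertex_in_D[OF v] by blast
  qed
  \<comment> \<open>All vertices are on one frontier and hence pairwise adjacent, so three of them
    already give three edges, against the bound of two.\<close>
  obtain T where "T \<subseteq> V" "card T = 3" using card_V obtain_subset_with_card_n by metis
  then obtain a b c where abc: "a \<in> V" "b \<in> V" "c \<in> V" "a \<noteq> b" "b \<noteq> c" "a \<noteq> c"
    unfolding card_3_iff by blast
  then have "{{a, b}, {b, c}, {a, c}} \<subseteq> E"
    using frontier_vertices_adjacent[OF F] all by auto
  moreover have "card {{a, b}, {b, c}, {a, c}} = 3"
    using abc by (simp add: doubleton_eq_iff card_insert_if)
  ultimately show False
    using c2 Eb card_mono[OF finite_E, of "{{a, b}, {b, c}, {a, c}}"] by simp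
qed

lemma face_triangle:
  assumes F: "F \<in> Faces"
  obtains a b c where "distinct [a, b, c]" "bdry F = {{a, b}, {b, c}, {a, c}}"
    "{v \<in> V. p v \<in> frontier F} = {a, b, c}"
proof -
  define X where "X = {v \<in> V. p v \<in> frontier F}"
  have "finite X" using finite_V by (simp add: X_def)
  have "card X \<le> 3"
  proof (rule ccontr)
    assume "\<not> card X \<le> 3"
    then have "4 \<le> card X" by simp
    then obtain T where "T \<subseteq> X" "card T = 4" by (rule obtain_subset_with_card_n)
    moreover obtain xs where "set xs = T" "distinct xs"
      using finite_distinct_list[OF finite_subset[OF \<open>T \<subseteq> X\<close> \<open>finite X\<close>]] by blast
    ultimately have "length xs = 4" by (metis distinct_card)
    then obtain a b c d where "xs = [a, b, c, d]"
      by (auto simp: numeral_eq_Suc length_Suc_conv)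
    then have dist: "distinct [a, b, c, d]" and "{a, b, c, d} \<subseteq> X"
      using \<open>distinct xs\<close> \<open>set xs = T\<close> \<open>T \<subseteq> X\<close> by auto
    then have V: "a \<in> V" "b \<in> V" "c \<in> V" "d \<in> V" and fr: "p a \<in> frontier F" "p b \<in> frontier F"
      "p c \<in> frontier F" "p d \<in> frontier F" by (auto simp: X_def)
    show False
      by (rule no_four_clique_on_face[OF F dist _ _ _ _ _ _ fr])
         (use dist V fr in \<open>auto intro!: frontier_vertices_adjacent[OF F]\<close>)
  qed
  have sub: "bdry F \<subseteq> {e. e \<subseteq> X \<and> card e = 2}"
    using boundary_edge_vertex[of _ F] edge_card by (auto simp: X_def boundary_edges_def)
  have fin: "finite {e. e \<subseteq> X \<and> card e = 2}" using \<open>finite X\<close> by simp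
  have num: "card {e. e \<subseteq> X \<and> card e = 2} = card X choose 2"
    using n_subsets[OF \<open>finite X\<close>] .
  \<comment> \<open>Two or fewer vertices give at most one pair, so there are exactly three, and
    three boundary edges use up all pairs.\<close>
  have "3 \<le> card X choose 2"
    using boundary_edges_ge_3[OF F] card_mono[OF fin sub] num by simp
  then have "card X \<noteq> 0" "card X \<noteq> 1" "card X \<noteq> 2" by (auto simp: choose_two)
  then have "card X = 3" using \<open>card X \<le> 3\<close> by linarith
  then obtain a b c where abc: "X = {a, b, c}" "a \<noteq> b" "b \<noteq> c" "a \<noteq> c" unfolding card_3_iff by blast
  have "bdry F = {e. e \<subseteq> X \<and> card e = 2}"
    using boundary_edges_ge_3[OF F] num \<open>card X = 3\<close> card_mono[OF fin sub]
    by (intro card_subset_eq[OF fin sub]) (simp add: choose_two)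
  also have "\<dots> = {{a, b}, {b, c}, {a, c}}"
    unfolding abc(1) using abc(2-4) by (auto simp: card_2_iff doubleton_eq_iff)
  finally show thesis using that abc unfolding X_def by auto
qed

lemma card_boundary_edges: "F \<in> Faces \<Longrightarrow> card (bdry F) = 3"
  by (erule face_triangle) (auto simp: doubleton_eq_iff card_insert_if)

text \<open>Two edges of the triangle form an arc that the third one closes. All vertices on the
  frontier are corners of the triangle, so nothing else belongs to it.\<close>

lemma face_frontier_jordan_curve:
  assumes F: "F \<in> Faces"
  obtains j where "simple_path j" "pathfinish j = pathstart j" "path_image j = frontier F"
proof -
  obtain a b c where abc: "distinct [a, b, c]" "bdry F = {{a, b}, {b, c}, {a, c}}"
    "{v \<in> V. p v \<in> frontier F} = {a, b, c}"
    by (rule face_triangle[OF F])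
  have e: "{a, b} \<in> E" "{b, c} \<in> E" "{a, c} \<in> E" using abc(2) by (auto simp: boundary_edges_def)
  obtain g1 where g1: "arc g1" "pathstart g1 = p a" "pathfinish g1 = p b" "path_image g1 = path_image (\<gamma> {a, b})"
    using oriented_arc[OF e(1)] by metis
  obtain g2 where g2: "arc g2" "pathstart g2 = p b" "pathfinish g2 = p c" "path_image g2 = path_image (\<gamma> {b, c})"
    using oriented_arc[OF e(2)] by metis
  obtain g3 where g3: "arc g3" "pathstart g3 = p a" "pathfinish g3 = p c" "path_image g3 = path_image (\<gamma> {a, c})"
    using oriented_arc[OF e(3)] by metis
  have m12: "path_image g1 \<inter> path_image g2 \<subseteq> {p b}"
  proof -
    have "{a, b} \<inter> {b, c} = {b}" "{a, b} \<noteq> {b, c}" using abc(1) by auto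
    then show ?thesis unfolding g1(4) g2(4) using edge_meet[OF e(1,2)] by (metis image_empty image_insert)
  qed
  have m13: "path_image g1 \<inter> path_image g3 \<subseteq> {p a}"
  proof -
    have "{a, b} \<inter> {a, c} = {a}" "{a, b} \<noteq> {a, c}" using abc(1) by auto
    then show ?thesis unfolding g1(4) g3(4) using edge_meet[OF e(1,3)] by (metis image_empty image_insert)
  qed
  have m23: "path_image g2 \<inter> path_image g3 \<subseteq> {p c}"
  proof -
    have "{b, c} \<inter> {a, c} = {c}" "{b, c} \<noteq> {a, c}" using abc(1) by auto
    then show ?thesis unfolding g2(4) g3(4) using edge_meet[OF e(2,3)] by (metis image_empty image_insert)
  qed
  have "arc (g1 +++ g2)" using g1 g2 m12 by (intro arc_join) auto
  moreover have "path_image (g1 +++ g2) = path_image g1 \<union> path_image g2" using g1 g2 by (simp add: path_image_join)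
  moreover have "(path_image g1 \<union> path_image g2) \<inter> path_image g3 = {p a, p c}"
    using m13 m23 pathstart_in_path_image[of g1] pathfinish_in_path_image[of g2]
      pathstart_in_path_image[of g3] pathfinish_in_path_image[of g3] g1 g2 g3 by auto
  ultimately have j: "simple_path ((g1 +++ g2) +++ reversepath g3)"
    "pathfinish ((g1 +++ g2) +++ reversepath g3) = pathstart ((g1 +++ g2) +++ reversepath g3)"
    "path_image ((g1 +++ g2) +++ reversepath g3) = path_image g1 \<union> path_image g2 \<union> path_image g3"
    using jordan_curve_of_arcs[of "g1 +++ g2" "p a" "p c" g3] g1 g2 g3 by simp_all
  have "path_image g1 \<union> path_image g2 \<union> path_image g3 = (\<Union>e\<in>bdry F. path_image (\<gamma> e))"
    unfolding abc(2) g1 g2 g3 by auto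
  also have "\<dots> = frontier F"
  proof
    show "(\<Union>e\<in>bdry F. path_image (\<gamma> e)) \<subseteq> frontier F" by (auto simp: boundary_edges_def)
    have "p ` {a, b, c} \<subseteq> path_image g1 \<union> path_image g2 \<union> path_image g3"
      using pathstart_in_path_image[of g1] pathfinish_in_path_image[of g1]
        pathfinish_in_path_image[of g2] g1 g2 by auto
    then have "p ` {a, b, c} \<subseteq> (\<Union>e\<in>bdry F. path_image (\<gamma> e))"
      unfolding abc(2) g1 g2 g3 by blast
    then show "frontier F \<subseteq> (\<Union>e\<in>bdry F. path_image (\<gamma> e))"
      using frontier_face_subset[OF F] unfolding abc(3) by blast
  qed
  finally show thesis using that j by metis
qed

text \<open>If both local sides of \<open>e\<close> were the same face \<open>F\<close>, points of
  \<open>F\<close> near the midpoint would lie both inside and outside the Jordan curve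
  \<open>frontier F\<close>, which the connected set \<open>F\<close> does not meet.\<close>

lemma card_sides:
  assumes e: "e \<in> E"
  shows "card (sides e) = 2"
proof -
  obtain F G where FG: "sides e = {F, G}"
    "\<forall>x\<in>path_image (\<gamma> e) - p ` e. \<exists>\<delta>>0. ball x \<delta> \<subseteq> path_image (\<gamma> e) \<union> F \<union> G"
    by (rule edge_two_sides[OF e, folded sides_def])
  have "F \<noteq> G"
  proof
    assume "F = G"
    have F: "F \<in> Faces" "path_image (\<gamma> e) \<subseteq> frontier F"
      using FG(1) mem_sides[of F e] by (auto simp: boundary_edges_def)
    obtain j where j: "simple_path j" "pathfinish j = pathstart j" "path_image j = frontier F"
      using face_frontier_jordan_curve[OF F(1)] by metis
    let ?x = "edge_midpoint \<gamma> e"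
    obtain \<delta> where \<delta>: "0 < \<delta>" "ball ?x \<delta> \<subseteq> path_image (\<gamma> e) \<union> F"
      using bspec[OF FG(2) midpoint_interior[OF e]] \<open>F = G\<close> by auto
    have meets: "F \<inter> S \<noteq> {}" if S: "frontier S = frontier F" "S \<inter> frontier F = {}" for S
    proof -
      have "?x \<in> closure S" using S(1) F(2) midpoint_interior[OF e] by (auto simp: frontier_def)
      then obtain y where "y \<in> S" "y \<in> ball ?x \<delta>"
        using \<delta>(1) by (metis closure_approachable dist_commute mem_ball)
      then show ?thesis using \<delta>(2) F(2) S(2) by blast
    qed
    have "inside (frontier F) \<inter> F \<noteq> {}" "outside (frontier F) \<inter> F \<noteq> {}"
      using Jordan_inside_outside[OF j(1,2)] meets unfolding j(3)
      by (metis Int_commute inside_no_overlap outside_no_overlap)+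
    then have "frontier F \<inter> F \<noteq> {}"
      using inside_outside_intersect_connected face_connected[OF F(1)] by metis
    then show False using frontier_face[OF F(1)] by blast
  qed
  then show ?thesis using FG(1) by simp
qed

section \<open>Bounded faces and their links across edges\<close>

lemma finite_Faces: "finite Faces"
proof -
  have "Faces \<subseteq> (\<Union>e\<in>E. sides e)"
  proof
    fix F assume F: "F \<in> Faces"
    then obtain e where "e \<in> bdry F" using card_boundary_edges by fastforce
    then show "F \<in> (\<Union>e\<in>E. sides e)" using F by (auto simp: boundary_edges_def mem_sides)
  qed
  moreover have "finite (\<Union>e\<in>E. sides e)"
  proof (rule finite_UN_I[OF finite_E])
    fix e assume "e \<in> E"
    then show "finite (sides e)" using card_sides[of e] card_ge_0_finite[of "sides e"] by linarith
  qed
  ultimately show ?thesis by (rule finite_subset)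
qed

lemma unbounded_face:
  obtains U where "U \<in> Faces" "\<not> bounded U" "\<And>F. F \<in> Faces \<Longrightarrow> \<not> bounded F \<Longrightarrow> F = U"
proof -
  have "bounded (- (- D))" using compact_D compact_imp_bounded by simp
  then obtain U where "U \<in> Faces" "\<not> bounded U"
    using cobounded_unbounded_components unfolding faces_def by blast
  moreover have "F = U" if "F \<in> Faces" "\<not> bounded F" for F
    using cobounded_unique_unbounded_components[OF \<open>bounded (- (- D))\<close>, of U F] calculation that
    unfolding faces_def by simp
  ultimately show thesis using that by blast
qed

text \<open>Otherwise every edge with two bounded sides has both or neither of them in
  \<open>A\<close>. The inside of the outer triangle without the vertices then falls apart into two
  open sets, one around the faces in \<open>A\<close> and one around the remaining bounded
  faces.\<close>

lemma bounded_faces_linked: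
  assumes A: "A \<subseteq> {F \<in> Faces. bounded F}" "A \<noteq> {}" "A \<noteq> {F \<in> Faces. bounded F}"
  shows "\<exists>F\<in>A. \<exists>G\<in>{F \<in> Faces. bounded F} - A. bdry F \<inter> bdry G \<noteq> {}"
proof (rule ccontr)
  assume none: "\<not> ?thesis"
  define B where "B = {F \<in> Faces. bounded F}"
  obtain U where U: "U \<in> Faces" "\<not> bounded U" "\<And>F. F \<in> Faces \<Longrightarrow> \<not> bounded F \<Longrightarrow> F = U"
    using unbounded_face by metis
  obtain j where j: "simple_path j" "pathfinish j = pathstart j" "path_image j = frontier U"
    using face_frontier_jordan_curve[OF U(1)] by metis
  define I where "I = inside (frontier U)"
  note jordan = Jordan_inside_outside[OF j(1,2), unfolded j(3)]
  have I: "connected I" "open I" "bounded I" "connected (outside (frontier U))" using jordan unfolding I_def by blast+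
  have disj: "U \<inter> frontier U = {}" using frontier_face[OF U(1)] by blast
  have Ucover: "U \<subseteq> I \<union> outside (frontier U)"
    using disj inside_Un_outside[of "frontier U"] unfolding I_def by blast
  have "\<not> U \<subseteq> I" using I(3) U(2) bounded_subset by blast
  then have "U \<inter> outside (frontier U) \<noteq> {}" using Ucover by blast
  \<comment> \<open>The outside is connected, misses \<open>frontier U\<close> and meets
    \<open>U\<close>. The other faces are thereby left with the inside \<open>I\<close>.\<close>
  then have "outside (frontier U) \<subseteq> U"
    using connected_Int_frontier[OF I(4), of U] outside_no_overlap[of "frontier U"] by blast
  have cover: "- frontier U = I \<union> outside (frontier U)" using inside_Un_outside[of "frontier U"] unfolding I_def by blast
  have IU: "I \<inter> U = {}"
    using inside_outside_intersect_connected[OF face_connected[OF U(1)], of "frontier U"]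
      \<open>U \<inter> outside (frontier U) \<noteq> {}\<close> disj unfolding I_def by blast
  have in_I: "F \<subseteq> I" if "F \<in> B" for F
  proof -
    have F: "F \<in> Faces" "F \<noteq> U" using that U(2) by (auto simp: B_def)
    have "F \<inter> U = {}" "F \<inter> frontier U = {}"
      using face_eq[OF F(1) U(1)] F(2) face_disjoint[OF F(1)] face_frontier[OF U(1)] by blast+
    then show ?thesis using cover \<open>outside (frontier U) \<subseteq> U\<close> by blast
  qed
  \<comment> \<open>An open edge is added only if all its faces belong to \<open>C\<close>; this
    makes \<open>R C\<close> open and keeps \<open>R A\<close> and \<open>R (B - A)\<close>
    disjoint.\<close>
  define R where "R C = \<Union>C \<union> (\<Union>e\<in>{e \<in> E. sides e \<subseteq> C}. path_image (\<gamma> e) - p ` e)" for C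
  have R_edge: "x \<in> R C" if "e \<in> E" "sides e \<subseteq> C" "x \<in> path_image (\<gamma> e) - p ` e" for e x C
    unfolding R_def by (intro UnI2 UN_I[of e] CollectI conjI) (fact that)+
  have R_cases: "(\<exists>F\<in>C. x \<in> F) \<or> (\<exists>e\<in>E. sides e \<subseteq> C \<and> x \<in> path_image (\<gamma> e) - p ` e)" if "x \<in> R C" for x C
    using that unfolding R_def by blast
  have open_R: "open (R C)" if C: "C \<subseteq> Faces" for C
    unfolding open_contains_ball
  proof
    fix x assume "x \<in> R C"
    then consider F where "F \<in> C" "x \<in> F" | e where "e \<in> E" "sides e \<subseteq> C" "x \<in> path_image (\<gamma> e) - p ` e"
      using R_cases by blast
    then show "\<exists>\<delta>>0. ball x \<delta> \<subseteq> R C"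
    proof cases
      case 1
      then obtain \<delta> where "0 < \<delta>" "ball x \<delta> \<subseteq> F"
        using face_open C open_contains_ball by (metis subsetD)
      then show ?thesis using 1 unfolding R_def by blast
    next
      case 2
      obtain F G where FG: "sides e = {F, G}"
        "\<forall>x\<in>path_image (\<gamma> e) - p ` e. \<exists>\<delta>>0. ball x \<delta> \<subseteq> path_image (\<gamma> e) \<union> F \<union> G"
        by (rule edge_two_sides[OF 2(1), folded sides_def])
      obtain \<delta> where \<delta>: "0 < \<delta>" "ball x \<delta> \<subseteq> path_image (\<gamma> e) \<union> F \<union> G" using bspec[OF FG(2) 2(3)] by blast
      have "open (- p ` e)" "x \<in> - p ` e"
        using 2 edge_subset[OF 2(1)] finite_V
        by (auto intro!: open_Compl finite_imp_closed intro: finite_subset)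
      then obtain \<delta>' where \<delta>': "0 < \<delta>'" "ball x \<delta>' \<subseteq> - p ` e"
        using open_contains_ball by blast
      have "ball x (min \<delta> \<delta>') \<subseteq> ball x \<delta> \<inter> ball x \<delta>'" by auto
      then have "ball x (min \<delta> \<delta>') \<subseteq> (path_image (\<gamma> e) - p ` e) \<union> F \<union> G" using \<delta>(2) \<delta>'(2) by blast
      also have "\<dots> \<subseteq> R C" using 2 FG(1) unfolding R_def by blast
      finally show ?thesis using \<delta>(1) \<delta>'(1) by (intro exI[of _ "min \<delta> \<delta>'"]) simp
    qed
  qed
  define Z where "Z = I - p ` V"
  have "connected Z"
    unfolding Z_def using I finite_V by (intro connected_open_diff_countable) (auto simp: countable_finite)
  have AB: "A \<subseteq> B" "B \<subseteq> Faces" using A by (auto simp: B_def)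
  have "Z \<subseteq> R A \<union> R (B - A)"
  proof
    fix z assume z: "z \<in> Z"
    show "z \<in> R A \<union> R (B - A)"
    proof (cases "z \<in> D")
      case False
      then obtain F where "F \<in> Faces" "z \<in> F" using point_in_face by blast
      moreover from this have "F \<in> B" using z IU U(3) unfolding Z_def B_def by blast
      ultimately show ?thesis unfolding R_def by blast
    next
      case True
      then obtain e where e: "e \<in> E" "z \<in> path_image (\<gamma> e) - p ` e"
        using z edge_subset unfolding Z_def drawing_def by blast
      have "z \<notin> frontier U" using z inside_no_overlap[of "frontier U"] unfolding Z_def I_def by blast
      \<comment> \<open>An edge with the unbounded face at its side lies on
        \<open>frontier U\<close>, but \<open>z\<close> does not.\<close>
      have "sides e \<subseteq> B"
      proof
        fix G assume G: "G \<in> sides e"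
        then have "G \<in> Faces" "path_image (\<gamma> e) \<subseteq> frontier G" by (auto simp: mem_sides boundary_edges_def)
        moreover from this have "G \<noteq> U" using e(2) \<open>z \<notin> frontier U\<close> by blast
        ultimately show "G \<in> B" using U(3)[of G] unfolding B_def by blast
      qed
      moreover have "sides e \<subseteq> A \<or> sides e \<inter> A = {}"
      proof (rule ccontr)
        assume "\<not> (sides e \<subseteq> A \<or> sides e \<inter> A = {})"
        then obtain F G where "F \<in> sides e" "F \<in> A" "G \<in> sides e" "G \<notin> A" by blast
        moreover from this have "G \<in> B - A" "e \<in> bdry F \<inter> bdry G" using \<open>sides e \<subseteq> B\<close> by (auto simp: mem_sides)
        ultimately show False using none unfolding B_def by blast
      qed
      ultimately have "sides e \<subseteq> A \<or> sides e \<subseteq> B - A" by blast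
      then show ?thesis using R_edge[OF e(1) _ e(2)] by blast
    qed
  qed
  moreover have "R A \<inter> R (B - A) \<inter> Z = {}"
  proof -
    have 1: "F \<inter> G = {}" if "F \<in> A" "G \<in> B - A" for F G using that AB face_eq by blast
    have 2: "F \<inter> path_image (\<gamma> e) = {}" if "F \<in> B" "e \<in> E" for F e
      using that AB face_disjoint edge_subset_D by blast
    have 3: "x \<notin> path_image (\<gamma> f) - p ` f" if "e \<in> E" "f \<in> E" "sides e \<subseteq> A" "sides f \<subseteq> B - A" "x \<in> path_image (\<gamma> e) - p ` e" for e f x
    proof
      assume "x \<in> path_image (\<gamma> f) - p ` f"
      then have "e = f" using interior_not_on_other_edge[OF that(1,2,5)] by blast
      then have "sides e = {}" using that by blast
      then show False using card_sides[OF that(1)] by simp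
    qed
    have "x \<notin> R (B - A)" if x: "x \<in> R A" for x
    proof
      assume x': "x \<in> R (B - A)"
      show False
      proof (cases "\<exists>F\<in>A. x \<in> F")
        case True
        then obtain F where F: "F \<in> A" "x \<in> F" by blast
        then show False using R_cases[OF x'] 1[OF F(1)] 2[of F] AB(1) by blast
      next
        case False
        then obtain e where e: "e \<in> E" "sides e \<subseteq> A" "x \<in> path_image (\<gamma> e) - p ` e"
          using R_cases[OF x] by blast
        then show False using R_cases[OF x'] 3[OF e(1) _ e(2) _ e(3)] 2[OF _ e(1)] by blast
      qed
    qed
    then show ?thesis by blast
  qed
  moreover have "R C \<inter> Z \<noteq> {}" if C: "C \<subseteq> B" "C \<noteq> {}" for C
  proof -
    obtain F where F: "F \<in> C" using C by blast
    then have "F \<in> B" "F \<in> Faces" using C AB by blast+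
    then obtain x where x: "x \<in> F" using face_nonempty by blast
    then have "x \<notin> p ` V" using face_disjoint[OF \<open>F \<in> Faces\<close>] vertex_in_D by blast
    then have "x \<in> Z" using x in_I[OF \<open>F \<in> B\<close>] unfolding Z_def by blast
    moreover have "x \<in> R C" unfolding R_def using F x by blast
    ultimately show ?thesis by blast
  qed
  then have "R A \<inter> Z \<noteq> {}" "R (B - A) \<inter> Z \<noteq> {}" using A AB(1) unfolding B_def[symmetric] by blast+
  moreover have "open (R A)" "open (R (B - A))" using open_R AB by (meson Diff_subset order_trans)+
  ultimately show False
    using connectedD[OF \<open>connected Z\<close>, of "R A" "R (B - A)"] by blast
qed

end

subsection \<open>Eulerian circuits of linked triangles\<close>

text \<open>Lets a circuit start at the vertex where the next triangle is attached.\<close>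

lemma closed_walk_rotate:
  assumes "closed_walk E ends vs es"
  shows "closed_walk E ends (rotate n vs) (rotate n es)"
proof -
  let ?l = "length es"
  have w: "es \<noteq> []" "length vs = ?l" "set es \<subseteq> E"
    "\<And>i. i < ?l \<Longrightarrow> ends (es ! i) = {vs ! i, vs ! (Suc i mod ?l)}"
    using assms by (auto simp: closed_walk_def)
  have "ends (rotate n es ! i) = {rotate n vs ! i, rotate n vs ! (Suc i mod ?l)}" if "i < ?l" for i
  proof -
    have "Suc i mod ?l < ?l" using w(1) by simp
    then have "rotate n vs ! (Suc i mod ?l) = vs ! ((n + Suc i mod ?l) mod ?l)"
      using w(2) nth_rotate[of "Suc i mod ?l" vs n] by simp
    also have "(n + Suc i mod ?l) mod ?l = Suc ((n + i) mod ?l) mod ?l"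
      by (simp add: mod_Suc_eq mod_add_right_eq)
    finally show ?thesis
      using that w(1,2) w(4)[of "(n + i) mod ?l"] nth_rotate[of i es n] nth_rotate[of i vs n] by simp
  qed
  then show ?thesis using w by (simp add: closed_walk_def)
qed

lemma count_list_rotate1: "count_list (rotate1 xs) x = count_list xs x"
  by (cases xs) simp_all

lemma count_list_rotate: "count_list (rotate n xs) x = count_list xs x"
  by (induction n) (simp_all add: count_list_rotate1)

lemma eulerian_circuit_rotate:
  "eulerian_circuit E ends vs es \<Longrightarrow> eulerian_circuit E ends (rotate n vs) (rotate n es)"
  by (simp add: eulerian_circuit_def closed_walk_rotate count_list_rotate)

lemma eulerian_circuit_edges:
  assumes "eulerian_circuit E ends vs es"
  shows "set es = E" "distinct es"
proof -
  have *: "set es \<subseteq> E" "\<And>e. e \<in> E \<Longrightarrow> count_list es e = 1"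
    using assms by (auto simp: eulerian_circuit_def closed_walk_def)
  show set: "set es = E"
    using * by (metis count_notin subsetI subset_antisym zero_neq_one)
  have "length es = sum (count_list es) (set es)"
    by (simp add: sum_count_set)
  also have "\<dots> = card (set es)" using * set by simp
  finally show "distinct es" by (simp add: card_distinct)
qed

text \<open>Position \<open>i\<close> of the walk is charged to the two ends of its edge,
  \<open>vs ! i\<close> and the cyclically next vertex \<open>rotate1 vs ! i\<close>. These differ
  as there are no loops, and rotation preserves counts, so each passage through \<open>v\<close>
  accounts for two edges.\<close>

lemma eulerian_circuit_count:
  assumes circuit: "eulerian_circuit E ends vs es" and simple: "\<And>e. e \<in> E \<Longrightarrow> card (ends e) = 2"
  shows "2 * count_list vs v = card {e \<in> E. v \<in> ends e}"
proof -
  let ?l = "length es"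
  note es = eulerian_circuit_edges[OF circuit]
  have w: "es \<noteq> []" "length vs = ?l"
    "\<And>i. i < ?l \<Longrightarrow> ends (es ! i) = {vs ! i, rotate1 vs ! i}"
    using circuit by (auto simp: closed_walk_def eulerian_circuit_def nth_rotate1)
  have ne: "vs ! i \<noteq> rotate1 vs ! i" if "i < ?l" for i
    using simple[of "es ! i"] w(3)[OF that] es(1) that by (auto simp: card_2_iff)
  have count: "card {i. i < length xs \<and> xs ! i = v} = count_list xs v" for xs
    using length_filter_conv_card[of "(=) v" xs] by (simp add: count_list_eq_length_filter eq_commute[of _ v])
  have "card {e \<in> E. v \<in> ends e} = length (filter (\<lambda>e. v \<in> ends e) es)"
    using es distinct_card[of "filter (\<lambda>e. v \<in> ends e) es"] by simp
  also have "\<dots> = card {i. i < ?l \<and> v \<in> ends (es ! i)}"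
    by (rule length_filter_conv_card)
  also have "{i. i < ?l \<and> v \<in> ends (es ! i)} = {i. i < ?l \<and> vs ! i = v} \<union> {i. i < ?l \<and> rotate1 vs ! i = v}"
    using w(3) by auto
  also have "card \<dots> = card {i. i < ?l \<and> vs ! i = v} + card {i. i < ?l \<and> rotate1 vs ! i = v}"
  proof (rule card_Un_disjoint)
    show "{i. i < ?l \<and> vs ! i = v} \<inter> {i. i < ?l \<and> rotate1 vs ! i = v} = {}"
    proof (rule ccontr)
      assume "{i. i < ?l \<and> vs ! i = v} \<inter> {i. i < ?l \<and> rotate1 vs ! i = v} \<noteq> {}"
      then obtain i where "i < ?l" "vs ! i = v" "rotate1 vs ! i = v" by blast
      then show False using ne[of i] by simp
    qed
  qed simp_all
  also have "\<dots> = count_list vs v + count_list (rotate1 vs) v"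
    using count[of vs] count[of "rotate1 vs"] w(2) by simp
  also have "count_list (rotate1 vs) v = count_list vs v"
    by (rule count_list_rotate1)
  finally show ?thesis by simp
qed

text \<open>The combinatorial form of \<open>conj_edges\<close>. An edge carries its triangle, so
  the edge sets of different triangles are disjoint even where corners are shared.\<close>

definition triangle_edges :: "'f set \<Rightarrow> ('f \<Rightarrow> 'x set) \<Rightarrow> ('f \<times> 'x set) set" where
  "triangle_edges X T = {(F, {x, y}) | F x y. F \<in> X \<and> x \<in> T F \<and> y \<in> T F \<and> x \<noteq> y}"

lemma triangle_edges_insert: "triangle_edges (insert G X) T = triangle_edges X T \<union> triangle_edges {G} T"
  unfolding triangle_edges_def by auto

lemma triangle_edges_single:
  assumes "T G = {x, y, z}" "distinct [x, y, z]"
  shows "triangle_edges {G} T = {(G, {x, y}), (G, {y, z}), (G, {z, x})}"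
  unfolding triangle_edges_def using assms by (auto simp: doubleton_eq_iff)

lemma eulerian_circuit_triangle:
  assumes "T G = {x, y, z}" "distinct [x, y, z]"
  shows "eulerian_circuit (triangle_edges {G} T) snd [x, y, z] [(G, {x, y}), (G, {y, z}), (G, {z, x})]"
  unfolding triangle_edges_single[of T G x y z, OF assms] eulerian_circuit_def closed_walk_def
  using assms(2) by (auto simp: less_Suc_eq doubleton_eq_iff)

text \<open>The old walk closes up at \<open>x\<close>, so the triangle can be traversed from there
  before the walk starts over.\<close>

lemma eulerian_circuit_splice_triangle:
  assumes circuit: "eulerian_circuit (triangle_edges X T) snd vs es" and x: "vs ! 0 = x"
    and G: "G \<notin> X" "T G = {x, y, z}" "distinct [x, y, z]"
  shows "eulerian_circuit (triangle_edges (insert G X) T) snd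
           (vs @ [x, y, z]) (es @ [(G, {x, y}), (G, {y, z}), (G, {z, x})])"
proof -
  let ?l = "length es" and ?us = "vs @ [x, y, z]" and ?t = "[(G, {x, y}), (G, {y, z}), (G, {z, x})]"
  have w: "es \<noteq> []" "length vs = ?l" "set es \<subseteq> triangle_edges X T"
    "\<And>i. i < ?l \<Longrightarrow> snd (es ! i) = {vs ! i, vs ! (Suc i mod ?l)}"
    "\<And>e. e \<in> triangle_edges X T \<Longrightarrow> count_list es e = 1"
    using circuit by (auto simp: closed_walk_def eulerian_circuit_def)
  have new: "(G, S) \<notin> triangle_edges X T" for S
    using G(1) by (auto simp: triangle_edges_def)
  have ends: "snd ((es @ ?t) ! i) = {?us ! i, ?us ! (Suc i mod (?l + 3))}" if i: "i < ?l + 3" for i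
  proof -
    consider "Suc i < ?l" | "Suc i = ?l" | "i = ?l" | "i = Suc ?l" | "i = Suc (Suc ?l)"
      using i by linarith
    then show ?thesis
    proof cases
      case 1
      then show ?thesis using w(2) w(4)[of i] by (simp add: nth_append)
    next
      \<comment> \<open>The last old edge used to return to \<open>vs ! 0\<close>; it now leads to
        the appended \<open>x\<close>, which is the same vertex.\<close>
      case 2
      then have "i < ?l" "Suc i mod ?l = 0" by auto
      then show ?thesis using 2 w(2) w(4)[of i] x by (simp add: nth_append)
    next
      case 3
      then show ?thesis using w(2) by (simp add: nth_append)
    next
      case 4
      then show ?thesis using w(2) by (simp add: nth_append)
    next
      case 5
      then have "Suc i = ?l + 3" by simp
      then have "Suc i mod (?l + 3) = 0" by (metis mod_self)
      moreover have "?us ! 0 = x" using w(1,2) x by (simp add: nth_append)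
      ultimately show ?thesis using 5 w(2) by (simp add: nth_append)
    qed
  qed
  have count: "count_list (es @ ?t) e = 1" if e: "e \<in> triangle_edges (insert G X) T" for e
  proof (cases "e \<in> triangle_edges X T")
    case True
    then have "e \<notin> set ?t" using new by auto
    then have "count_list ?t e = 0" by (rule count_notin)
    then show ?thesis using w(5)[OF True] by (simp only: count_list_append)
  next
    case False
    then have "e \<notin> set es" using w(3) by blast
    then have "count_list es e = 0" by simp
    have "e \<in> triangle_edges {G} T" using e[unfolded triangle_edges_insert[of G X T]] False by (metis UnE)
    then have "count_list ?t e = 1"
      using eulerian_circuit_triangle[of T G x y z, OF G(2,3)] unfolding eulerian_circuit_def by blast
    then show ?thesis using \<open>count_list es e = 0\<close> by (simp only: count_list_append)
  qed
  have sub: "set (es @ ?t) \<subseteq> triangle_edges (insert G X) T"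
  proof -
    have "set ?t = triangle_edges {G} T"
      unfolding triangle_edges_single[of T G x y z, OF G(2,3)] by simp
    then show ?thesis using w(3) unfolding set_append triangle_edges_insert[of G X T] by blast
  qed
  have len: "length (es @ ?t) = ?l + 3" "length ?us = ?l + 3" "es @ ?t \<noteq> []"
    using w(2) by simp_all
  show ?thesis
    unfolding eulerian_circuit_def closed_walk_def len(1,2)
    by (intro conjI allI impI ballI len(3) refl sub ends count)
qed

text \<open>\<open>linked\<close> supplies a further triangle with a corner on one already absorbed.
  The induction counts \<open>Suc n\<close> triangles because a closed walk has at least one
  edge.\<close>

lemma eulerian_circuit_linked_triangles:
  assumes X: "finite X" "X \<noteq> {}" and tri: "\<And>F. F \<in> X \<Longrightarrow> card (T F) = 3"
    and linked: "\<And>Y. Y \<subseteq> X \<Longrightarrow> Y \<noteq> {} \<Longrightarrow> Y \<noteq> X \<Longrightarrow> \<exists>F\<in>Y. \<exists>G\<in>X - Y. T F \<inter> T G \<noteq> {}"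
  shows "\<exists>vs es. eulerian_circuit (triangle_edges X T) snd vs es"
proof -
  have corners: "\<exists>y z. T F = {x, y, z} \<and> distinct [x, y, z]" if F: "F \<in> X" "x \<in> T F" for F x
  proof -
    have "card (T F - {x}) = 2" using tri[OF F(1)] F(2) by (simp add: card_Diff_singleton)
    then obtain y z where yz: "T F - {x} = {y, z}" "y \<noteq> z" by (auto simp: card_2_iff)
    then have "T F = {x, y, z}" "x \<noteq> y" "x \<noteq> z" using F(2) by auto
    then show ?thesis using yz(2) by auto
  qed
  have "\<exists>Y\<subseteq>X. card Y = Suc n \<and> (\<exists>vs es. eulerian_circuit (triangle_edges Y T) snd vs es)"
    if "Suc n \<le> card X" for n
    using that
  proof (induction n)
    case 0
    obtain F where F: "F \<in> X" using X by blast
    have "T F \<noteq> {}" using tri[OF F] by auto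
    then obtain x where "x \<in> T F" by blast
    then obtain y z where "T F = {x, y, z}" "distinct [x, y, z]" using corners[OF F] by metis
    then have "eulerian_circuit (triangle_edges {F} T) snd [x, y, z] [(F, {x, y}), (F, {y, z}), (F, {z, x})]"
      by (rule eulerian_circuit_triangle)
    then have "\<exists>vs es. eulerian_circuit (triangle_edges {F} T) snd vs es"
      by blast
    then show ?case using F by (intro exI[of _ "{F}"]) simp
  next
    case (Suc n)
    then obtain Y vs es where Y: "Y \<subseteq> X" "card Y = Suc n" and c: "eulerian_circuit (triangle_edges Y T) snd vs es"
      by auto
    have "Y \<noteq> {}" "Y \<noteq> X" using Y Suc.prems by auto
    then have "\<exists>F\<in>Y. \<exists>G\<in>X - Y. T F \<inter> T G \<noteq> {}" by (intro linked Y(1))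
    then obtain F G x where FG: "F \<in> Y" "G \<in> X" "G \<notin> Y" "x \<in> T F" "x \<in> T G" by blast
    have "F \<in> X" using FG(1) Y(1) by blast
    obtain y' z' where F: "T F = {x, y', z'}" "distinct [x, y', z']" using corners[OF \<open>F \<in> X\<close> FG(4)] by metis
    obtain y z where G: "T G = {x, y, z}" "distinct [x, y, z]" using corners[OF FG(2,5)] by metis
    \<comment> \<open>The circuit uses an edge of \<open>F\<close> at \<open>x\<close>, so
      \<open>x\<close> occurs on it and it can be rotated to start there.\<close>
    have "(F, {x, y'}) \<in> triangle_edges Y T"
      unfolding triangle_edges_def using FG(1) F by fastforce
    then have "(F, {x, y'}) \<in> set es" using eulerian_circuit_edges(1)[OF c] by simp
    then obtain i where i: "i < length es" "es ! i = (F, {x, y'})" by (auto simp: in_set_conv_nth)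
    have w: "length vs = length es" "snd (es ! i) = {vs ! i, vs ! (Suc i mod length es)}"
      using c i(1) by (auto simp: eulerian_circuit_def closed_walk_def)
    have "Suc i mod length es < length es" using i(1) by (intro mod_less_divisor) linarith
    moreover have "x = vs ! i \<or> x = vs ! (Suc i mod length es)" using w(2) i(2) by auto
    ultimately obtain k where k: "k < length vs" "vs ! k = x" using i(1) w(1) by metis
    have "rotate k vs ! 0 = x" using k nth_rotate[of 0 vs k] by (cases vs) auto
    from eulerian_circuit_splice_triangle[OF eulerian_circuit_rotate[OF c] this FG(3) G]
    have "\<exists>vs es. eulerian_circuit (triangle_edges (insert G Y) T) snd vs es" by blast
    moreover have "card (insert G Y) = Suc (Suc n)"
      using Y FG(3) X(1) finite_subset by (metis card_insert_disjoint)
    ultimately show ?case using Y(1) FG(2) by (intro exI[of _ "insert G Y"]) simp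
  qed
  from this[of "card X - 1"] obtain Y where "Y \<subseteq> X" "card Y = card X"
    "\<exists>vs es. eulerian_circuit (triangle_edges Y T) snd vs es"
    using X by (auto simp: card_gt_0_iff Suc_diff_1)
  then show ?thesis using card_subset_eq[OF X(1)] by metis
qed

text \<open>Each triangle with corner \<open>v\<close> contributes one edge for each of its two
  other corners; \<open>?h\<close> is this correspondence.\<close>

lemma triangle_edges_degree:
  assumes X: "finite X" and tri: "\<And>F. F \<in> X \<Longrightarrow> card (T F) = 3"
  shows "card {e \<in> triangle_edges X T. v \<in> snd e} = 2 * card {F \<in> X. v \<in> T F}"
proof -
  let ?S = "SIGMA F:{F \<in> X. v \<in> T F}. T F - {v}"
  let ?h = "\<lambda>(F, y). (F, {v, y})"
  have "{e \<in> triangle_edges X T. v \<in> snd e} = ?h ` ?S"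
  proof
    show "?h ` ?S \<subseteq> {e \<in> triangle_edges X T. v \<in> snd e}"
      unfolding triangle_edges_def by auto
    show "{e \<in> triangle_edges X T. v \<in> snd e} \<subseteq> ?h ` ?S"
    proof
      fix e assume "e \<in> {e \<in> triangle_edges X T. v \<in> snd e}"
      then obtain F x y where e: "e = (F, {x, y})" "F \<in> X" "x \<in> T F" "y \<in> T F" "x \<noteq> y" "v = x \<or> v = y"
        by (auto simp: triangle_edges_def)
      then have "e = ?h (F, if v = x then y else x)" "(F, if v = x then y else x) \<in> ?S"
        by (auto simp: insert_commute)
      then show "e \<in> ?h ` ?S" by (rule image_eqI)
    qed
  qed
  moreover have "inj_on ?h ?S" by (auto simp: inj_on_def doubleton_eq_iff)
  ultimately have "card {e \<in> triangle_edges X T. v \<in> snd e} = card ?S" by (simp add: card_image)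
  also have "\<dots> = (\<Sum>F\<in>{F \<in> X. v \<in> T F}. card (T F - {v}))"
    using X tri by (intro card_SigmaI) (auto intro: card_ge_0_finite)
  also have "\<dots> = (\<Sum>F\<in>{F \<in> X. v \<in> T F}. 2)"
    using tri by (intro sum.cong) auto
  finally show ?thesis by simp
qed

lemma triangle_edges_card_ends: "e \<in> triangle_edges X T \<Longrightarrow> card (snd e) = 2"
  by (auto simp: triangle_edges_def)

subsection \<open>The conjugated triangulation\<close>

context maximal_plane_graph begin

abbreviation "bounded_faces \<equiv> {F \<in> Faces. bounded F}"
abbreviation "midpoints F \<equiv> edge_midpoint \<gamma> ` bdry F"

lemma inj_on_edge_midpoint: "inj_on (edge_midpoint \<gamma>) E"
proof (rule inj_onI)
  fix e f assume "e \<in> E" "f \<in> E" "edge_midpoint \<gamma> e = edge_midpoint \<gamma> f"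
  then show "e = f"
    using interior_not_on_other_edge[of e f "edge_midpoint \<gamma> e"] midpoint_interior[of e] midpoint_interior[of f]
    by simp
qed

lemma bdry_subset: "bdry F \<subseteq> E"
  by (auto simp: boundary_edges_def)

lemma card_midpoints: "F \<in> Faces \<Longrightarrow> card (midpoints F) = 3"
  using card_boundary_edges bdry_subset inj_on_subset[OF inj_on_edge_midpoint] by (simp add: card_image)

lemma midpoint_mem_iff: "e \<in> E \<Longrightarrow> edge_midpoint \<gamma> e \<in> midpoints F \<longleftrightarrow> e \<in> bdry F"
  using inj_on_image_mem_iff[OF inj_on_edge_midpoint _ bdry_subset] by blast

text \<open>One side asks for distinct edges, the other for distinct points; these agree because
  different edges have different midpoints.\<close>

lemma conj_edges_eq: "conj_edges V E p \<gamma> = triangle_edges bounded_faces midpoints"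
proof -
  have "edge_midpoint \<gamma> e \<noteq> edge_midpoint \<gamma> f" if "e \<in> bdry F" "f \<in> bdry F" "e \<noteq> f" for e f F
    using that bdry_subset inj_on_edge_midpoint by (metis inj_onD subsetD)
  then show ?thesis unfolding conj_edges_def triangle_edges_def by blast
qed

text \<open>The second side of an edge of the unbounded face is bounded.\<close>

lemma bounded_face_exists: "bounded_faces \<noteq> {}"
proof -
  obtain U where U: "U \<in> Faces" "\<not> bounded U" "\<And>F. F \<in> Faces \<Longrightarrow> \<not> bounded F \<Longrightarrow> F = U"
    using unbounded_face by metis
  obtain e where "e \<in> bdry U" using card_boundary_edges[OF U(1)] by fastforce
  then have "card (sides e) = 2" using bdry_subset card_sides by blast
  then have "\<not> sides e \<subseteq> {U}" using card_mono[of "{U}" "sides e"] by auto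
  then show ?thesis using U(3) by (auto simp: mem_sides)
qed

lemma conj_eulerian_circuit: "\<exists>vs es. eulerian_circuit (conj_edges V E p \<gamma>) snd vs es"
  unfolding conj_edges_eq
proof (rule eulerian_circuit_linked_triangles)
  show "finite bounded_faces" using finite_Faces by simp
  show "bounded_faces \<noteq> {}" by (rule bounded_face_exists)
  show "card (midpoints F) = 3" if "F \<in> bounded_faces" for F using that card_midpoints by simp
  fix Y assume "Y \<subseteq> bounded_faces" "Y \<noteq> {}" "Y \<noteq> bounded_faces"
  from bounded_faces_linked[OF this]
  show "\<exists>F\<in>Y. \<exists>G\<in>bounded_faces - Y. midpoints F \<inter> midpoints G \<noteq> {}" by blast
qed

text \<open>External vertices are defined by the faces of the conjugated drawing. That drawing stays
  clear of the unbounded face \<open>U\<close> of the triangulation, so \<open>U\<close> lies in an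
  unbounded face \<open>C\<close> of it, and a midpoint on \<open>frontier U\<close> is also on
  \<open>frontier C\<close>.\<close>

lemma inner_midpoint_sides_bounded:
  assumes draw: "conj_drawing V E p \<gamma> \<delta>" and e: "e \<in> E"
    and inner: "inner_vertex (conj_verts E \<gamma>) (conj_edges V E p \<gamma>) (\<lambda>x. x) \<delta> (edge_midpoint \<gamma> e)"
  shows "sides e \<subseteq> bounded_faces"
proof (rule ccontr)
  assume "\<not> sides e \<subseteq> bounded_faces"
  then obtain U where "U \<in> sides e" "U \<notin> bounded_faces" by blast
  then have U: "U \<in> Faces" "e \<in> bdry U" "\<not> bounded U" by (auto simp: mem_sides)
  let ?H = "drawing (conj_verts E \<gamma>) (conj_edges V E p \<gamma>) (\<lambda>x. x) \<delta>"
  have vD: "conj_verts E \<gamma> \<subseteq> D"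
    using midpoint_interior edge_subset_D by (auto simp: conj_verts_def)
  \<comment> \<open>The arc of \<open>(F, S)\<close> runs in the bounded face \<open>F\<close>
    except for its ends, which are points of the drawing \<open>D\<close>.\<close>
  have "path_image (\<delta> k) \<inter> U = {}" if k: "k \<in> conj_edges V E p \<gamma>" for k
  proof -
    obtain F S where FS: "k = (F, S)" by (cases k)
    have F: "F \<in> Faces" "bounded F" "S \<subseteq> conj_verts E \<gamma>"
      using k bdry_subset unfolding FS conj_edges_def conj_verts_def by blast+
    have "path_image (\<delta> k) - S \<subseteq> F"
      using draw k unfolding FS conj_drawing_def by blast
    moreover have "F \<inter> U = {}" using face_eq[OF F(1) U(1)] F(2) U(3) by blast
    moreover have "S \<inter> U = {}" using F(3) vD face_disjoint[OF U(1)] by blast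
    ultimately show ?thesis by blast
  qed
  then have "U \<subseteq> - ?H"
    using vD face_disjoint[OF U(1)] unfolding drawing_def by auto
  moreover have "- ?H \<noteq> {}" using calculation face_nonempty[OF U(1)] by blast
  ultimately obtain C where C: "C \<in> components (- ?H)" "U \<subseteq> C"
    using exists_component_superset face_connected[OF U(1)] by metis
  have "edge_midpoint \<gamma> e \<in> closure U"
    using U(2) midpoint_interior[OF e] by (auto simp: boundary_edges_def frontier_def)
  then have "edge_midpoint \<gamma> e \<in> closure C" using closure_mono[OF C(2)] by blast
  moreover have "edge_midpoint \<gamma> e \<in> ?H" using e by (auto simp: drawing_def conj_verts_def)
  then have "edge_midpoint \<gamma> e \<notin> interior C"
    using in_components_subset[OF C(1)] interior_subset by blast
  ultimately have "edge_midpoint \<gamma> e \<in> frontier C" by (simp add: frontier_def)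
  moreover have "\<not> bounded C" using C(2) U(3) bounded_subset by blast
  ultimately show False
    using inner C(1) unfolding inner_vertex_def external_vertex_def faces_def by blast
qed

text \<open>Twice the count is the degree, and the degree is twice the number of bounded faces at
  the edge, which for an inner midpoint are all of \<open>sides e\<close>.\<close>

lemma conj_inner_vertex_count:
  assumes draw: "conj_drawing V E p \<gamma> \<delta>"
    and circuit: "eulerian_circuit (conj_edges V E p \<gamma>) snd vs es"
    and inner: "inner_vertex (conj_verts E \<gamma>) (conj_edges V E p \<gamma>) (\<lambda>x. x) \<delta> v"
  shows "count_list vs v = 2"
proof -
  obtain e where e: "e \<in> E" "v = edge_midpoint \<gamma> e"
    using inner by (auto simp: inner_vertex_def conj_verts_def)
  have "{F \<in> bounded_faces. v \<in> midpoints F} = sides e"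
    using inner_midpoint_sides_bounded[OF draw e(1)] inner midpoint_mem_iff[OF e(1)]
    unfolding e(2) by (auto simp: mem_sides)
  moreover have "card {k \<in> triangle_edges bounded_faces midpoints. v \<in> snd k} =
      2 * card {F \<in> bounded_faces. v \<in> midpoints F}"
    using finite_Faces card_midpoints by (intro triangle_edges_degree) auto
  moreover have "2 * count_list vs v = card {k \<in> triangle_edges bounded_faces midpoints. v \<in> snd k}"
    by (rule eulerian_circuit_count[OF circuit[unfolded conj_edges_eq]]) (rule triangle_edges_card_ends)
  ultimately show ?thesis using card_sides[OF e(1)] by simp
qed

end

text \<open>Degrees alone determine the number of passages, which is why the count holds for every
  Eulerian circuit and not just for a constructed one.\<close>

theorem theorem7:
  fixes V :: "'v set" and E :: "'v set set"
    and p :: "'v \<Rightarrow> complex" and \<gamma> :: "'v set \<Rightarrow> real \<Rightarrow> complex"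
    and \<delta> :: "complex set \<times> complex set \<Rightarrow> real \<Rightarrow> complex"
  assumes "planar_triangulation V E"
    and "card V \<ge> 3"
    and "plane_embedding V E (\<lambda>e. e) p \<gamma>"
    and "conj_drawing V E p \<gamma> \<delta>"
  shows "(\<exists>vs es. eulerian_circuit (conj_edges V E p \<gamma>) snd vs es) \<and>
         (\<forall>vs es. eulerian_circuit (conj_edges V E p \<gamma>) snd vs es \<longrightarrow>
            (\<forall>v. inner_vertex (conj_verts E \<gamma>) (conj_edges V E p \<gamma>) (\<lambda>x. x) \<delta> v \<longrightarrow>
                 count_list vs v = 2))"
proof -
  have tri: "simple_graph V E" "\<And>e. e \<subseteq> V \<Longrightarrow> card e = 2 \<Longrightarrow> e \<notin> E \<Longrightarrow> \<not> planar V (insert e E)"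
    using assms(1) by (simp_all add: planar_triangulation_def)
  interpret maximal_plane_graph V E p \<gamma>
    by unfold_locales (fact tri assms)+
  show ?thesis
  proof (intro conjI allI impI)
    show "\<exists>vs es. eulerian_circuit (conj_edges V E p \<gamma>) snd vs es"
      by (rule conj_eulerian_circuit)
  qed (rule conj_inner_vertex_count[OF assms(4)])
qed

end
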